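(* Let $m,n\ge 1$ be integers. For any point arrangement $\bar{\mathbf q}=(\bar q_1,\ldots,\bar q_n)\in(\mathbf P^3)^n$ such that no four of the points are coplanar, we have $$ I\big(\Gamma^{m,n}_{\bar{\mathbf q},\mathbf p}\big)=I_m(\bar{\mathbf q}), $$ and the set of all $k$-focals of $\bar{\mathbf q}$ for $6\le k\le 12$ forms a universal Gröbner basis for this ideal (that is, a Gröbner basis with respect to every monomial order on $\mathbf C[\mathbf p]$).
   Context: Everything is over $\mathbf C$; $[n]=\{1,\dots,n\}$. Points of $\mathbf P^{11}=\mathbf P(\mathrm{Hom}_{\mathbf C}(\mathbf C^4,\mathbf C^3))$ are $3\times 4$ matrices up to scale (cameras). Write $Aq\sim p$ if $Aq$ and $p$ represent the same point of $\mathbf P^2$. The image formation correspondence is the Zariski closure $$\Gamma^{m,n}_{\mathbf A,\mathbf q,\mathbf p}=\overline{\{(\mathbf A,\mathbf q,\mathbf p)\in(\mathbf P^{11})^m\times(\mathbf P^3)^n\times(\mathbf P^2)^{mn} \mid A_iq_j\sim p_{ij}\ \ \forall i\in[m],\,j\in[n]\}}.$$ For $\bar{\mathbf q}\in(\mathbf P^3)^n$, the resectioning variety is $$\Gamma^{m,n}_{\bar{\mathbf q},\mathbf p}=\{\mathbf p\in(\mathbf P^2)^{mn}\mid (\mathbf A,\bar{\mathbf q},\mathbf p)\in\Gamma^{m,n}_{\mathbf A,\mathbf q,\mathbf p}\text{ for some }\mathbf A\in(\mathbf P^{11})^m\},$$ and $I(\Gamma^{m,n}_{\bar{\mathbf q},\mathbf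 p})\subset\mathbf C[\mathbf p]$ is its multihomogeneous vanishing ideal, where $\mathbf C[\mathbf p]$ is the polynomial ring in the $3mn$ entries of the vectors $p_{ij}$ of homogeneous coordinates ($i\in[m]$, $j\in[n]$). For each $j$, fixing homogeneous coordinates of $\bar q_j$, set $\bar Q_j=I_{3\times3}\otimes\bar q_j^{\top}$, the $3\times 12$ block-diagonal matrix with three diagonal blocks equal to $\bar q_j^\top$. For a set $\{\sigma_1,\dots,\sigma_k\}\subset[n]$ of size $k\ge 6$ and $i\in[m]$, a $k$-focal of $\bar{\mathbf q}$ is any maximal, i.e. $(12+k)\times(12+k)$, minor of the $3k\times(12+k)$ matrix $$\begin{bmatrix}\bar Q_{\sigma_1}&p_{i\sigma_1}&\cdots&0\\ \vdots&\vdots&\ddots&\vdots\\ \bar Q_{\sigma_k}&0&\cdots&p_{i\sigma_k}\end{bmatrix}.$$ The focal ideal $I_m(\bar{\mathbf q})\subset\mathbf C[\mathbf p]$ is the ideal generated by all $k$-focals, $6\le k\le n$ (over all $i\in[m]$ and all such subsets). *)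

theory Defs
  imports
    "HOL-Analysis.Cartesian_Space"
    "HOL-Library.Numeral_Type"
    "HOL-Library.Poly_Mapping"
    "Jordan_Normal_Form.Determinant"
    "Jordan_Normal_Form.DL_Submatrix"
begin

no_notation Matrix.vec_index (infixl \<open>$\<close> 100)

type_synonym 'v monomial = "'v \<Rightarrow>\<^sub>0 nat"
type_synonym 'v cpoly = "'v monomial \<Rightarrow>\<^sub>0 complex"

definition Const :: "complex \<Rightarrow> 'v cpoly" where
  "Const c = Poly_Mapping.single 0 c"

definition Var :: "'v \<Rightarrow> 'v cpoly" where
  "Var v = Poly_Mapping.single (Poly_Mapping.single v 1) 1"

definition eval_poly :: "('v \<Rightarrow> complex) \<Rightarrow> 'v cpoly \<Rightarrow> complex" where
  "eval_poly x f =
     (\<Sum>t\<in>Poly_Mapping.keys f. Poly_Mapping.lookup f t *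
        (\<Prod>v\<in>Poly_Mapping.keys t. x v ^ Poly_Mapping.lookup t v))"

definition ideal_gen :: "'v cpoly set \<Rightarrow> 'v cpoly set" where
  "ideal_gen B = Modules.module.span (*) B"

text \<open>
  A map \<open>blk\<close> sorts the variables into blocks, one block of homogeneous coordinates for each
  projective factor. A point of the product is given by homogeneous coordinates, that is, by a
  function on the variables that does not vanish identically on any block. Subsets of the product
  are represented by sets of such coordinate functions; the Zariski closure is then automatically
  stable under rescaling each block.
\<close>

definition multihomogeneous :: "('v \<Rightarrow> 'b) \<Rightarrow> 'v cpoly \<Rightarrow> bool" where
  "multihomogeneous blk f \<longleftrightarrow>
     (\<exists>d. \<forall>t\<in>Poly_Mapping.keys f. \<forall>b.
        (\<Sum>v\<in>{v \<in> Poly_Mapping.keys t. blk v = b}. Poly_Mapping.lookup t v) = (d b :: nat))"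

definition multiproj_coords :: "('v \<Rightarrow> 'b) \<Rightarrow> ('v \<Rightarrow> complex) set" where
  "multiproj_coords blk = {x. \<forall>b\<in>range blk. \<exists>v. blk v = b \<and> x v \<noteq> 0}"

definition zariski_closure :: "('v \<Rightarrow> 'b) \<Rightarrow> ('v \<Rightarrow> complex) set \<Rightarrow> ('v \<Rightarrow> complex) set" where
  "zariski_closure blk X =
     {x \<in> multiproj_coords blk.
        \<forall>f. multihomogeneous blk f \<and> (\<forall>y\<in>X. eval_poly y f = 0) \<longrightarrow> eval_poly x f = 0}"

definition vanishing_ideal :: "('v \<Rightarrow> 'b) \<Rightarrow> ('v \<Rightarrow> complex) set \<Rightarrow> 'v cpoly set" where
  "vanishing_ideal blk X =
     ideal_gen {f. multihomogeneous blk f \<and> (\<forall>x\<in>X. eval_poly x f = 0)}"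

text \<open>The zero vector represents no point, so no image point is related to the centre of a camera.\<close>

definition same_point :: "complex^'k \<Rightarrow> complex^'k \<Rightarrow> bool" where
  "same_point x y \<longleftrightarrow> x \<noteq> 0 \<and> y \<noteq> 0 \<and> (\<exists>c. x = c *s y)"

definition coplanar_points :: "(complex^4) set \<Rightarrow> bool" where
  "coplanar_points S \<longleftrightarrow> (\<exists>h::complex^4. h \<noteq> 0 \<and> (\<forall>x\<in>S. (\<Sum>c\<in>UNIV. h $ c * x $ c) = 0))"

text \<open>
  The finite types \<open>'m\<close> and \<open>'n\<close> index the cameras and the points. Coordinates in
  \<^typ>\<open>complex^3\<close> and \<^typ>\<open>complex^4\<close> are indexed by the types \<open>3\<close> and \<open>4\<close>, whose elements are the
  residues, so that \<open>of_nat\<close> enumerates them from \<open>0\<close>.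
\<close>

datatype ('m, 'n) ifc_var = CamV 'm 3 4 | PtV 'n 4 | ImgV 'm 'n 3

datatype ('m, 'n) ifc_block = CamB 'm | PtB 'n | ImgB 'm 'n

fun ifc_blk :: "('m, 'n) ifc_var \<Rightarrow> ('m, 'n) ifc_block" where
  "ifc_blk (CamV i r c) = CamB i"
| "ifc_blk (PtV j c) = PtB j"
| "ifc_blk (ImgV i j r) = ImgB i j"

fun ifc_coords ::
  "('m \<Rightarrow> complex^4^3) \<Rightarrow> ('n \<Rightarrow> complex^4) \<Rightarrow> ('m \<Rightarrow> 'n \<Rightarrow> complex^3) \<Rightarrow> ('m, 'n) ifc_var \<Rightarrow> complex"
where
  "ifc_coords A q p (CamV i r c) = A i $ r $ c"
| "ifc_coords A q p (PtV j c) = q j $ c"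
| "ifc_coords A q p (ImgV i j r) = p i j $ r"

definition image_formation ::
  "(('m \<Rightarrow> complex^4^3) \<times> ('n \<Rightarrow> complex^4) \<times> ('m \<Rightarrow> 'n \<Rightarrow> complex^3)) set"
where
  "image_formation =
     {(A, q, p). ifc_coords A q p \<in> zariski_closure ifc_blk
        {ifc_coords A q p | A q p.
           (\<forall>i. A i \<noteq> 0) \<and> (\<forall>j. q j \<noteq> 0) \<and> (\<forall>i j. p i j \<noteq> 0) \<and>
           (\<forall>i j. same_point (A i *v q j) (p i j))}}"

definition resectioning_variety :: "('n \<Rightarrow> complex^4) \<Rightarrow> ('m \<Rightarrow> 'n \<Rightarrow> complex^3) set" where
  "resectioning_variety q = {p. \<exists>A. (A, q, p) \<in> image_formation}"

type_synonym ('m, 'n) img_var = "'m \<times> 'n \<times> 3"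

definition img_blk :: "('m, 'n) img_var \<Rightarrow> 'm \<times> 'n" where
  "img_blk = (\<lambda>(i, j, r). (i, j))"

definition img_coords :: "('m \<Rightarrow> 'n \<Rightarrow> complex^3) \<Rightarrow> ('m, 'n) img_var \<Rightarrow> complex" where
  "img_coords p = (\<lambda>(i, j, r). p i j $ r)"

definition resectioning_ideal :: "('n \<Rightarrow> complex^4) \<Rightarrow> ('m, 'n) img_var cpoly set" where
  "resectioning_ideal q = vanishing_ideal img_blk (img_coords ` resectioning_variety q)"

definition Qbar :: "complex^4 \<Rightarrow> complex mat" where
  "Qbar x = Matrix.mat 3 12 (\<lambda>(a, c). if c div 4 = a then x $ of_nat (c mod 4) else 0)"

text \<open>The size-\<open>k\<close> subset of points is enumerated by a list \<open>\<sigma>\<close> without repetitions, \<open>k = length \<sigma>\<close>.\<close>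

definition focal_matrix ::
  "('n \<Rightarrow> complex^4) \<Rightarrow> 'm \<Rightarrow> 'n list \<Rightarrow> ('m, 'n) img_var cpoly mat"
where
  "focal_matrix q i \<sigma> = Matrix.mat (3 * length \<sigma>) (12 + length \<sigma>)
     (\<lambda>(r, c).
        if c < 12 then Const (Qbar (q (\<sigma> ! (r div 3))) $$ (r mod 3, c))
        else if c - 12 = r div 3 then Var (i, \<sigma> ! (r div 3), of_nat (r mod 3))
        else 0)"

definition focals :: "('n \<Rightarrow> complex^4) \<Rightarrow> nat \<Rightarrow> ('m, 'n) img_var cpoly set" where
  "focals q k =
     {Determinant.det (submatrix (focal_matrix q i \<sigma>) R UNIV) | i \<sigma> R.
        distinct \<sigma> \<and> length \<sigma> = k \<and> R \<subseteq> {..<3 * k} \<and> card R = 12 + k}"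

definition focal_ideal :: "('n::finite \<Rightarrow> complex^4) \<Rightarrow> ('m, 'n) img_var cpoly set" where
  "focal_ideal q = ideal_gen (\<Union>k\<in>{6..CARD('n)}. focals q k)"

definition monomial_order :: "'v monomial rel \<Rightarrow> bool" where
  "monomial_order r \<longleftrightarrow> well_order r \<and> (\<forall>s t u. (s, t) \<in> r \<longrightarrow> (s + u, t + u) \<in> r)"

definition lead_monomial :: "'v monomial rel \<Rightarrow> 'v cpoly \<Rightarrow> 'v monomial" where
  "lead_monomial r f =
     (THE t. t \<in> Poly_Mapping.keys f \<and> (\<forall>s\<in>Poly_Mapping.keys f. (s, t) \<in> r))"

definition lead_term :: "'v monomial rel \<Rightarrow> 'v cpoly \<Rightarrow> 'v cpoly" where
  "lead_term r f =
     Poly_Mapping.single (lead_monomial r f) (Poly_Mapping.lookup f (lead_monomial r f))"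

definition groebner_basis :: "'v monomial rel \<Rightarrow> 'v cpoly set \<Rightarrow> 'v cpoly set \<Rightarrow> bool" where
  "groebner_basis r G I \<longleftrightarrow>
     finite G \<and> G \<subseteq> I \<and>
     ideal_gen (lead_term r ` (G - {0})) = ideal_gen (lead_term r ` (I - {0}))"

definition universal_groebner_basis :: "'v cpoly set \<Rightarrow> 'v cpoly set \<Rightarrow> bool" where
  "universal_groebner_basis G I \<longleftrightarrow> (\<forall>r. monomial_order r \<longrightarrow> groebner_basis r G I)"

end

theory Submission
  imports Defs "HOL-Analysis.Determinants" "HOL-Analysis.Cartesian_Euclidean_Space"
begin

text \<open>
  Fix a monomial order and an element \<open>f \<noteq> 0\<close> of the ideal with leading monomial \<open>t\<close>, and represent the
  order on the finitely many relevant monomials by real weights \<open>w\<close>. For each camera \<open>i\<close> consider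
  potentials \<open>\<nu>\<close> on the three image coordinates, and say that a point \<open>j\<close> is bad for the coordinate \<open>r\<close> if
  \<open>w (i, j, r) + \<nu> r < w (i, j, r') + \<nu> r'\<close> for some variable \<open>(i, j, r')\<close> dividing \<open>t\<close>. By a covering
  argument on the plane of potentials, either some \<open>\<nu>\<close> has at most three bad points for every
  coordinate, or some \<open>\<nu>\<close> has at least four for every coordinate.

  If the first alternative held for all cameras, then, since any three of the points can be
  prescribed independently of the others, there would be a curve of cameras depending on \<open>s \<rightarrow> \<infinity>\<close>
  whose images (after rescaling) have coordinates of order at most \<open>s powr w\<close>, with equality on the
  variables dividing \<open>t\<close>. Along this curve the term \<open>t\<close> dominates \<open>f\<close>, which contradicts that \<open>f\<close>
  vanishes on the variety. (With at most three points, which may coincide, every choice of image points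
  lies in the variety, because the world points can be perturbed to linearly independent ones.) In the second alternative, four bad points for each of the three
  coordinates give the rows of a nonvanishing \<open>12 \<times> 12\<close> minor; adding for each point involved the row of
  a maximal variable dividing \<open>t\<close> gives a focal, and by linear programming duality for assignment
  problems its leading monomial is the product of these variables, a divisor of \<open>t\<close>.
\<close>

section \<open>Polynomials\<close>

definition monom_eval :: "('v \<Rightarrow> complex) \<Rightarrow> 'v monomial \<Rightarrow> complex" where
  "monom_eval x t = (\<Prod>v\<in>Poly_Mapping.keys t. x v ^ Poly_Mapping.lookup t v)"

lemma monom_eval_superset:
  assumes "finite K" "Poly_Mapping.keys t \<subseteq> K"
  shows "monom_eval x t = (\<Prod>v\<in>K. x v ^ Poly_Mapping.lookup t v)"
  unfolding monom_eval_def
  by (rule prod.mono_neutral_left) (use assms in \<open>auto simp: in_keys_iff\<close>)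

lemma monom_eval_0 [simp]: "monom_eval x 0 = 1"
  by (simp add: monom_eval_def)

lemma monom_eval_single [simp]: "monom_eval x (Poly_Mapping.single v (Suc 0)) = x v"
  by (simp add: monom_eval_def)

lemma monom_eval_add: "monom_eval x (s + t) = monom_eval x s * monom_eval x t"
proof -
  let ?K = "Poly_Mapping.keys s \<union> Poly_Mapping.keys t"
  have "monom_eval x (s + t) = (\<Prod>v\<in>?K. x v ^ Poly_Mapping.lookup (s + t) v)"
    by (rule monom_eval_superset) (use Poly_Mapping.keys_add[of s t] in auto)
  moreover have "monom_eval x s = (\<Prod>v\<in>?K. x v ^ Poly_Mapping.lookup s v)"
    "monom_eval x t = (\<Prod>v\<in>?K. x v ^ Poly_Mapping.lookup t v)"
    by (rule monom_eval_superset; auto)+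
  ultimately show ?thesis
    by (simp add: lookup_add power_add prod.distrib)
qed

lemma eval_poly_superset:
  assumes "finite K" "Poly_Mapping.keys f \<subseteq> K"
  shows "eval_poly x f = (\<Sum>t\<in>K. Poly_Mapping.lookup f t * monom_eval x t)"
  unfolding eval_poly_def monom_eval_def
  by (rule sum.mono_neutral_left) (use assms in \<open>auto simp: in_keys_iff\<close>)

lemma eval_poly_zero [simp]: "eval_poly x 0 = 0"
  by (simp add: eval_poly_def)

lemma eval_poly_single [simp]: "eval_poly x (Poly_Mapping.single t c) = c * monom_eval x t"
  by (subst eval_poly_superset[of "{t}"]) auto

lemma eval_poly_add: "eval_poly x (f + g) = eval_poly x f + eval_poly x g"
proof -
  let ?K = "Poly_Mapping.keys f \<union> Poly_Mapping.keys g"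
  have "finite ?K" "Poly_Mapping.keys (f + g) \<subseteq> ?K"
    using Poly_Mapping.keys_add[of f g] by auto
  then show ?thesis
    by (simp add: eval_poly_superset[of ?K] lookup_add distrib_right sum.distrib)
qed

lemma eval_poly_sum: "eval_poly x (sum f A) = (\<Sum>a\<in>A. eval_poly x (f a))"
  by (induction A rule: infinite_finite_induct) (auto simp: eval_poly_add)

lemma poly_sum_monomials:
  "f = (\<Sum>t\<in>Poly_Mapping.keys f. Poly_Mapping.single t (Poly_Mapping.lookup f t))"
  by (rule poly_mapping_eqI)
    (auto simp: lookup_sum lookup_single when_def in_keys_iff)

lemma eval_poly_mult: "eval_poly x (f * g) = eval_poly x f * eval_poly x g"
proof -
  let ?m = "\<lambda>f t. Poly_Mapping.single t (Poly_Mapping.lookup f t)"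
  have "f * g = (\<Sum>s\<in>Poly_Mapping.keys f. ?m f s) * (\<Sum>t\<in>Poly_Mapping.keys g. ?m g t)"
    by (metis poly_sum_monomials)
  also have "eval_poly x \<dots> = eval_poly x (\<Sum>s\<in>Poly_Mapping.keys f. ?m f s) *
      eval_poly x (\<Sum>t\<in>Poly_Mapping.keys g. ?m g t)"
    by (simp add: sum_product eval_poly_sum mult_single monom_eval_add mult_ac)
  finally show ?thesis
    by (simp flip: poly_sum_monomials)
qed

lemma eval_poly_one [simp]: "eval_poly x 1 = 1"
  by (simp flip: single_one)

lemma eval_poly_Const [simp]: "eval_poly x (Const c) = c"
  by (simp add: Const_def)

lemma eval_poly_Var [simp]: "eval_poly x (Var v) = x v"
  by (simp add: Var_def)

text \<open>Makes \<open>hom_det\<close> available: a focal is evaluated by evaluating the entries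
  of its matrix.\<close>

interpretation eval_poly: comm_ring_hom "eval_poly x"
  by standard (auto simp: eval_poly_add eval_poly_mult)

text \<open>Ideals are the submodules of the ring over itself, so facts about spans and subspaces
  apply to \<open>ideal_gen\<close>.\<close>

interpretation cpoly_module: Modules.module "(*) :: 'v cpoly \<Rightarrow> 'v cpoly \<Rightarrow> 'v cpoly"
  by standard (auto simp: algebra_simps)

text \<open>Used on the Leibniz expansion of a determinant, where a monomial of a product of entries
  picks one monomial from each entry. Coefficients may cancel, so only this direction holds.\<close>

lemma keys_prodE:
  assumes "t \<in> Poly_Mapping.keys (prod f A)" "finite A"
  obtains k where "\<And>a. a \<in> A \<Longrightarrow> k a \<in> Poly_Mapping.keys (f a)" "t = sum k A"
proof -
  have "\<exists>k. (\<forall>a\<in>A. k a \<in> Poly_Mapping.keys (f a)) \<and> t = sum k A"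
    using assms(2,1)
  proof (induction A arbitrary: t)
    case (insert a A)
    then obtain u v where u: "u \<in> Poly_Mapping.keys (f a)" "v \<in> Poly_Mapping.keys (prod f A)"
      "t = u + v"
      using Poly_Mapping.keys_mult[of "f a" "prod f A"] by auto
    with insert obtain k where k: "\<forall>a\<in>A. k a \<in> Poly_Mapping.keys (f a)" "v = sum k A"
      by blast
    have "sum (k(a := u)) A = sum k A"
      by (rule sum.cong) (use insert in auto)
    with insert u k show ?case
      by (intro exI[of _ "k(a := u)"]) auto
  qed (auto split: if_splits)
  with that show ?thesis by blast
qed

lemma lookup_monomial_mult:
  fixes f :: "'v cpoly"
  shows "Poly_Mapping.lookup (Poly_Mapping.single u c * f) (u + t) = c * Poly_Mapping.lookup f t"
proof -
  have "Poly_Mapping.lookup (Poly_Mapping.single u c * f) (u + t) =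
    (\<Sum>s\<in>Poly_Mapping.keys f. Poly_Mapping.lookup
      (Poly_Mapping.single u c * Poly_Mapping.single s (Poly_Mapping.lookup f s)) (u + t))"
    by (subst (1) poly_sum_monomials[of f]) (simp add: sum_distrib_left lookup_sum)
  also have "\<dots> = c * Poly_Mapping.lookup f t"
    by (auto simp: mult_single lookup_single when_def in_keys_iff)
  finally show ?thesis .
qed

lemma keys_monomial_mult:
  fixes f :: "'v cpoly"
  assumes "c \<noteq> 0"
  shows "Poly_Mapping.keys (Poly_Mapping.single u c * f) = (+) u ` Poly_Mapping.keys f"
proof
  show "Poly_Mapping.keys (Poly_Mapping.single u c * f) \<subseteq> (+) u ` Poly_Mapping.keys f"
    using Poly_Mapping.keys_mult[of "Poly_Mapping.single u c" f] assms by auto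
  show "(+) u ` Poly_Mapping.keys f \<subseteq> Poly_Mapping.keys (Poly_Mapping.single u c * f)"
    using assms by (auto simp: in_keys_iff lookup_monomial_mult)
qed

section \<open>Monomial orders\<close>

lemma monomial_orderD:
  assumes "monomial_order r"
  shows "(s, s) \<in> r" "(s, t) \<in> r \<Longrightarrow> (t, s) \<in> r \<Longrightarrow> s = t"
    "(s, t) \<in> r \<Longrightarrow> (t, u) \<in> r \<Longrightarrow> (s, u) \<in> r" "(s, t) \<in> r \<or> (t, s) \<in> r"
    "wf (r - Id)" "(s, t) \<in> r \<Longrightarrow> (s + u, t + u) \<in> r"
proof -
  have *: "well_order_on UNIV r" "\<And>s t u. (s, t) \<in> r \<Longrightarrow> (s + u, t + u) \<in> r"
    using assms unfolding monomial_order_def by auto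
  then have r: "linear_order_on UNIV r" "wf (r - Id)"
    by (auto simp: well_order_on_def)
  have "refl r" "antisym r" "trans r" "total r"
    using r(1) unfolding linear_order_on_def partial_order_on_def preorder_on_def by auto
  then show "(s, s) \<in> r" "(s, t) \<in> r \<Longrightarrow> (t, s) \<in> r \<Longrightarrow> s = t"
    "(s, t) \<in> r \<Longrightarrow> (t, u) \<in> r \<Longrightarrow> (s, u) \<in> r" "(s, t) \<in> r \<or> (t, s) \<in> r"
    by (auto dest: reflD antisymD transD simp: total_on_def) (metis reflD)
  show "wf (r - Id)" "(s, t) \<in> r \<Longrightarrow> (s + u, t + u) \<in> r"
    using r * by auto
qed

lemma lead_monomial_eqI:
  assumes "monomial_order r" "t \<in> Poly_Mapping.keys f"
    "\<And>s. s \<in> Poly_Mapping.keys f \<Longrightarrow> (s, t) \<in> r"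
  shows "lead_monomial r f = t"
  unfolding lead_monomial_def
  by (rule the_equality) (use assms monomial_orderD(2) in blast)+

lemma lead_monomial:
  assumes "monomial_order r" "f \<noteq> 0"
  shows "lead_monomial r f \<in> Poly_Mapping.keys f"
    "s \<in> Poly_Mapping.keys f \<Longrightarrow> (s, lead_monomial r f) \<in> r"
proof -
  have ex: "\<exists>t\<in>K. \<forall>s\<in>K. (s, t) \<in> r" if "finite K" "K \<noteq> {}" for K
    using that
  proof (induction rule: finite_ne_induct)
    case (insert a K)
    then obtain t where t: "t \<in> K" "\<forall>s\<in>K. (s, t) \<in> r" by blast
    with monomial_orderD[OF assms(1)] show ?case
      by (metis insert_iff)
  qed (use monomial_orderD[OF assms(1)] in auto)
  have "Poly_Mapping.keys f \<noteq> {}"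
    using assms(2) by simp
  from ex[OF finite_keys this] obtain t where
    t: "t \<in> Poly_Mapping.keys f" "\<forall>s\<in>Poly_Mapping.keys f. (s, t) \<in> r" by blast
  then have "lead_monomial r f = t"
    by (intro lead_monomial_eqI assms) auto
  with t show "lead_monomial r f \<in> Poly_Mapping.keys f"
    "s \<in> Poly_Mapping.keys f \<Longrightarrow> (s, lead_monomial r f) \<in> r" by auto
qed

lemma lead_monomial_monomial_mult:
  assumes r: "monomial_order r" and "f \<noteq> 0" "c \<noteq> 0"
  shows "lead_monomial r (Poly_Mapping.single u c * f) = u + lead_monomial r f"
proof (rule lead_monomial_eqI[OF r])
  show "u + lead_monomial r f \<in> Poly_Mapping.keys (Poly_Mapping.single u c * f)"
    using assms by (simp add: keys_monomial_mult lead_monomial)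
  show "(s, u + lead_monomial r f) \<in> r"
    if "s \<in> Poly_Mapping.keys (Poly_Mapping.single u c * f)" for s
    using that assms monomial_orderD(6)[OF r] lead_monomial(2)[OF r \<open>f \<noteq> 0\<close>]
    by (auto simp: keys_monomial_mult add.commute[of u])
qed

text \<open>Unique factorization embeds the monomials multiplicatively into the positive integers.\<close>

lemma monomial_order_exists: "\<exists>r :: ('v::finite) monomial rel. monomial_order r"
proof -
  have "infinite {p::nat. prime p}"
    by (simp add: primes_infinite)
  then obtain P :: "nat set" where P: "finite P" "card P = CARD('v)" "P \<subseteq> {p. prime p}"
    using infinite_arbitrarily_large by blast
  then obtain p :: "'v \<Rightarrow> nat" where p: "bij_betw p UNIV P"
    using finite_same_card_bij[of "UNIV :: 'v set" P] by auto
  then have prime: "prime (p v)" for v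
    using P(3) by (auto simp: bij_betw_def)
  have inj: "inj p"
    using p by (simp add: bij_betw_def)
  define \<phi> :: "'v monomial \<Rightarrow> nat" where
    "\<phi> t = (\<Prod>v\<in>UNIV. p v ^ Poly_Mapping.lookup t v)" for t
  have pos: "\<phi> t > 0" for t
    unfolding \<phi>_def by (intro prod_pos ballI zero_less_power prime_gt_0_nat prime)
  have add: "\<phi> (s + t) = \<phi> s * \<phi> t" for s t
    by (simp add: \<phi>_def lookup_add power_add prod.distrib)
  have mult: "multiplicity (p v) (\<phi> t) = Poly_Mapping.lookup t v" for t v
  proof -
    have "multiplicity (p v) (\<phi> t) = (\<Sum>u\<in>UNIV. multiplicity (p v) (p u ^ Poly_Mapping.lookup t u))"
      unfolding \<phi>_def
    proof (rule prime_elem_multiplicity_prod_distrib)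
      show "prime_elem (p v)" using prime by auto
      show "0 \<notin> (\<lambda>u. p u ^ Poly_Mapping.lookup t u) ` UNIV"
        using prime by (auto simp: image_iff) (metis prime_gt_0_nat)
    qed auto
    also have "\<dots> = (\<Sum>u\<in>UNIV. if u = v then Poly_Mapping.lookup t v else 0)"
    proof (rule sum.cong[OF refl])
      fix u
      show "multiplicity (p v) (p u ^ Poly_Mapping.lookup t u) =
          (if u = v then Poly_Mapping.lookup t v else 0)"
        using prime[of u] prime[of v] inj
        by (auto simp: multiplicity_distinct_prime_power inj_eq)
    qed
    finally show ?thesis by simp
  qed
  have inj\<phi>: "inj \<phi>"
    by (rule injI, rule poly_mapping_eqI) (metis mult)
  define r where "r = {(s, t). \<phi> s \<le> \<phi> t}"
  have "linear_order r"
    unfolding linear_order_on_def partial_order_on_def preorder_on_def r_def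
    by (auto simp: refl_on_def trans_def antisym_def total_on_def inj_eq[OF inj\<phi>])
  moreover have "wf (r - Id)"
    by (rule wf_subset[OF wf_measure[of \<phi>]]) (auto simp: r_def inj_eq[OF inj\<phi>] le_less)
  ultimately have "monomial_order r"
    unfolding monomial_order_def well_order_on_def by (auto simp: r_def add)
  then show ?thesis ..
qed

section \<open>Representing an order by weights\<close>

text \<open>Provides the value of the eliminated coordinate in Fourier--Motzkin elimination, where
  the vectors of either sign may be missing and so either set of bounds may be empty.\<close>

lemma real_between_finite:
  fixes L U :: "real set"
  assumes "finite L" "finite U" "\<And>l u. l \<in> L \<Longrightarrow> u \<in> U \<Longrightarrow> l < u"
  shows "\<exists>x. (\<forall>l\<in>L. l < x) \<and> (\<forall>u\<in>U. x < u)"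
proof (cases "L = {} \<or> U = {}")
  case True
  have "\<exists>x. \<forall>l\<in>L. l < x"
  proof (intro exI ballI)
    fix l assume "l \<in> L"
    then have "l \<le> Max (insert 0 L)" using assms(1) by simp
    then show "l < Max (insert 0 L) + 1" by linarith
  qed
  moreover have "\<exists>x. \<forall>u\<in>U. x < u"
  proof (intro exI ballI)
    fix u assume "u \<in> U"
    then have "Min (insert 0 U) \<le> u" using assms(2) by simp
    then show "Min (insert 0 U) - 1 < u" by linarith
  qed
  ultimately show ?thesis using True by auto
next
  case False
  then have "Max L < Min U"
    using assms by auto
  then obtain x where "Max L < x" "x < Min U"
    using dense by blast
  with False assms show ?thesis by (intro exI[of _ x]) auto
qed

text \<open>Fourier--Motzkin elimination: one coordinate is eliminated by passing to those positive
  combinations of pairs of vectors in which it cancels.\<close>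

lemma positive_cone_weight:
  fixes P :: "('v \<Rightarrow> int) set"
  assumes add: "\<And>d e. d \<in> P \<Longrightarrow> e \<in> P \<Longrightarrow> (\<lambda>v. d v + e v) \<in> P" and zero: "(\<lambda>_. 0) \<notin> P"
  shows "finite V \<Longrightarrow> finite F \<Longrightarrow> F \<subseteq> P \<Longrightarrow> (\<And>d v. d \<in> F \<Longrightarrow> v \<notin> V \<Longrightarrow> d v = 0) \<Longrightarrow>
    \<exists>w :: 'v \<Rightarrow> real. \<forall>d\<in>F. (\<Sum>v\<in>V. w v * d v) > 0"
proof (induction V arbitrary: F rule: finite_induct)
  case empty
  \<comment> \<open>With no coordinate left, a member of \<open>F\<close> would be the zero vector,
    which \<open>P\<close> excludes.\<close>
  have "F = {}"
  proof (rule ccontr)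
    assume "F \<noteq> {}"
    then obtain d where d: "d \<in> F" by blast
    then have "d = (\<lambda>_. 0)" using empty by auto
    with d empty zero show False by auto
  qed
  then show ?case by simp
next
  case (insert v V)
  have smult: "(\<lambda>x. int (Suc k) * d x) \<in> P" if "d \<in> P" for k d
  proof (induction k)
    case (Suc k)
    then have "(\<lambda>x. int (Suc k) * d x + d x) \<in> P" by (intro add that)
    then show ?case by (simp add: algebra_simps)
  qed (use that in simp)
  have smult: "(\<lambda>x. c * d x) \<in> P" if "d \<in> P" "c > 0" for c d
    using smult[OF that(1), of "nat (c - 1)"] that(2) by simp
  define F0 where "F0 = {d\<in>F. d v = 0}"
  define Fp where "Fp = {d\<in>F. d v > 0}"
  define Fm where "Fm = {d\<in>F. d v < 0}"
  \<comment> \<open>Both multipliers \<open>- e v\<close> and \<open>d v\<close> are positive on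
    \<open>Fp \<times> Fm\<close>, and the coordinate \<open>v\<close> cancels.\<close>
  define comb where "comb = (\<lambda>(d, e) x. (- e v) * d x + d v * (e x :: int))"
  define F' where "F' = F0 \<union> comb ` (Fp \<times> Fm)"
  have fin: "finite F0" "finite Fp" "finite Fm"
    using insert by (auto simp: F0_def Fp_def Fm_def)
  have comb: "comb (d, e) \<in> P" if "d \<in> Fp" "e \<in> Fm" for d e
  proof -
    have "(\<lambda>x. (- e v) * d x) \<in> P" "(\<lambda>x. d v * e x) \<in> P"
      using that insert.prems by (auto intro!: smult simp: Fp_def Fm_def simp del: mult_minus_left)
    from add[OF this] show ?thesis by (simp add: comb_def)
  qed
  have "\<exists>w :: 'v \<Rightarrow> real. \<forall>d\<in>F'. (\<Sum>v\<in>V. w v * d v) > 0"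
  proof (rule insert.IH)
    show "finite F'" using fin by (simp add: F'_def)
    show "F' \<subseteq> P" using comb insert.prems by (auto simp: F'_def F0_def)
    show "d x = 0" if "d \<in> F'" "x \<notin> V" for d x
    proof (cases "x = v")
      case False
      then have "e x = 0" if "e \<in> F" for e
        using that insert.prems(3) \<open>x \<notin> V\<close> by blast
      with that show ?thesis
        by (auto simp: F'_def F0_def Fp_def Fm_def comb_def) (metis mult_zero_right)
    qed (use that in \<open>auto simp: F'_def F0_def Fp_def Fm_def comb_def\<close>)
  qed
  then obtain w :: "'v \<Rightarrow> real" where w: "\<And>d. d \<in> F' \<Longrightarrow> (\<Sum>v\<in>V. w v * d v) > 0" by blast
  define S where "S d = (\<Sum>x\<in>V. w x * d x)" for d :: "'v \<Rightarrow> int"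
  \<comment> \<open>The weight \<open>y\<close> of \<open>v\<close> has to make
    \<open>y * d v + S d\<close> positive. Vectors in \<open>Fp\<close> bound \<open>y\<close> from
    below and those in \<open>Fm\<close> from above; the bounds are compatible because every
    \<open>comb (d, e)\<close> has positive weight.\<close>
  have "\<exists>y. (\<forall>l\<in>(\<lambda>d. - S d / d v) ` Fp. l < y) \<and> (\<forall>u\<in>(\<lambda>e. S e / (- e v)) ` Fm. y < u)"
  proof (rule real_between_finite)
    fix l u assume "l \<in> (\<lambda>d. - S d / d v) ` Fp" "u \<in> (\<lambda>e. S e / (- e v)) ` Fm"
    then obtain d e where de: "d \<in> Fp" "e \<in> Fm" "l = - S d / d v" "u = S e / (- e v)" by auto
    then have pos: "real_of_int (d v) > 0" "real_of_int (- e v) > 0" by (auto simp: Fp_def Fm_def)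
    have "0 < (\<Sum>x\<in>V. w x * comb (d, e) x)"
      using w[of "comb (d, e)"] de by (auto simp: F'_def)
    also have "\<dots> = (- e v) * S d + d v * S e"
      by (simp add: comb_def S_def sum_distrib_left algebra_simps sum.distrib sum_subtractf sum_negf)
    finally show "l < u"
      using pos by (simp add: de field_simps)
  qed (use fin in auto)
  then obtain y where y: "\<And>d. d \<in> Fp \<Longrightarrow> - S d / d v < y" "\<And>e. e \<in> Fm \<Longrightarrow> y < S e / (- e v)"
    by auto
  have "(\<Sum>x\<in>insert v V. (w(v := y)) x * d x) > 0" if d: "d \<in> F" for d
  proof -
    have "(\<Sum>x\<in>V. (w(v := y)) x * d x) = S d"
      unfolding S_def by (rule sum.cong) (use insert in auto)
    then have eq: "(\<Sum>x\<in>insert v V. (w(v := y)) x * d x) = y * d v + S d"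
      using insert by simp
    consider "d \<in> F0" | "d \<in> Fp" | "d \<in> Fm"
      using d by (force simp: F0_def Fp_def Fm_def)
    then show ?thesis
    proof cases
      case 1
      then show ?thesis using w[of d] eq by (simp add: F'_def F0_def S_def)
    next
      case 2
      then show ?thesis using y(1)[OF 2] eq by (simp add: Fp_def field_simps)
    next
      case 3
      then have "real_of_int (d v) < 0" by (simp add: Fm_def)
      then show ?thesis using y(2)[OF 3] eq by (simp add: field_simps)
    qed
  qed
  then show ?case by blast
qed

definition weight :: "('v::finite \<Rightarrow> real) \<Rightarrow> 'v monomial \<Rightarrow> real" where
  "weight w t = (\<Sum>v\<in>UNIV. w v * real (Poly_Mapping.lookup t v))"

lemma weight_add: "weight w (s + t) = weight w s + weight w t"
  by (simp add: weight_def lookup_add algebra_simps sum.distrib)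

lemma weight_0 [simp]: "weight w 0 = 0"
  by (simp add: weight_def)

lemma weight_single [simp]: "weight w (Poly_Mapping.single v (Suc 0)) = w v"
  by (simp add: weight_def lookup_single when_def if_distrib cong: if_cong)

lemma weight_sum: "weight w (sum f A) = (\<Sum>a\<in>A. weight w (f a))"
  by (induction A rule: infinite_finite_induct) (auto simp: weight_add)

text \<open>Exponent differences of strictly increasing pairs are closed under addition and never
  zero, so \<open>positive_cone_weight\<close> applies to the finitely many pairs from
  \<open>E\<close>. Finiteness matters: a lexicographic order in two variables is not given by one
  real weight on all monomials.\<close>

lemma monomial_order_weight:
  fixes r :: "('v::finite) monomial rel"
  assumes r: "monomial_order r" and "finite E"
  obtains w where "\<And>s t. s \<in> E \<Longrightarrow> t \<in> E \<Longrightarrow> (s, t) \<in> r \<Longrightarrow> s \<noteq> t \<Longrightarrow> weight w s < weight w t"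
proof -
  let ?d = "\<lambda>s t v. int (Poly_Mapping.lookup t v) - int (Poly_Mapping.lookup s v)"
  define P where "P = {?d s t | s t. (s, t) \<in> r \<and> s \<noteq> t}"
  define F where "F = (\<lambda>(s, t). ?d s t) ` {(s, t) \<in> E \<times> E. (s, t) \<in> r \<and> s \<noteq> t}"
  have "\<exists>w :: 'v \<Rightarrow> real. \<forall>d\<in>F. (\<Sum>v\<in>UNIV. w v * d v) > 0"
  proof (rule positive_cone_weight[where P = P])
    show "(\<lambda>_. 0) \<notin> P"
      by (auto simp: P_def fun_eq_iff intro: poly_mapping_eqI)
    show "finite F"
      unfolding F_def using \<open>finite E\<close>
      by (intro finite_imageI finite_subset[OF _ finite_cartesian_product[of E E]]) auto
    show "F \<subseteq> P" by (auto simp: F_def P_def)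
    fix d e assume "d \<in> P" "e \<in> P"
    then obtain s t s' t' where *: "d = ?d s t" "(s, t) \<in> r" "s \<noteq> t"
      "e = ?d s' t'" "(s', t') \<in> r" "s' \<noteq> t'" by (auto simp: P_def)
    have 1: "(s + s', t + s') \<in> r" "(t + s', t + t') \<in> r"
      using monomial_orderD(6)[OF r] * by (metis add.commute)+
    then have 2: "(s + s', t + t') \<in> r"
      using monomial_orderD(3)[OF r] by blast
    \<comment> \<open>Equality would squeeze \<open>t + s'\<close> between equal monomials;
      antisymmetry and cancellation then give \<open>s = t\<close>.\<close>
    have "s + s' \<noteq> t + t'"
      using 1 * monomial_orderD(2)[OF r, of "s + s'" "t + s'"] by auto
    then show "(\<lambda>v. d v + e v) \<in> P"
      unfolding P_def using 2 by (intro CollectI exI[of _ "s + s'"] exI[of _ "t + t'"])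
        (auto simp: * lookup_add)
  qed auto
  then obtain w :: "'v \<Rightarrow> real" where w: "\<And>d. d \<in> F \<Longrightarrow> (\<Sum>v\<in>UNIV. w v * d v) > 0" by blast
  have "weight w s < weight w t" if "s \<in> E" "t \<in> E" "(s, t) \<in> r" "s \<noteq> t" for s t
  proof -
    have "?d s t \<in> F" using that by (auto simp: F_def)
    from w[OF this] show ?thesis
      by (simp add: weight_def right_diff_distrib sum_subtractf)
  qed
  with that show ?thesis by blast
qed

section \<open>A dichotomy for potentials\<close>

text \<open>An instance of the Knaster--Kuratowski--Mazurkiewicz covering argument: follow the boundary
  curve \<open>x = \<alpha> y\<close> of the first region and use that the real line is connected.\<close>

lemma three_regions_meet:
  fixes P1 P2 P3 :: "real \<Rightarrow> real \<Rightarrow> bool" and c :: real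
  assumes cover: "\<And>x y. P1 x y \<or> P2 x y \<or> P3 x y"
    and open1: "open {z. P1 (fst z) (snd z)}" and open2: "open {z. P2 (fst z) (snd z)}"
    and open3: "open {z. P3 (fst z) (snd z)}"
    and mono: "\<And>x x' y y'. P1 x y \<Longrightarrow> x' \<le> x \<Longrightarrow> y \<le> y' \<Longrightarrow> P1 x' y'"
    and shift: "\<And>x y d. P1 (x + d) (y + d) \<Longrightarrow> d \<ge> 0 \<Longrightarrow> P1 x y"
    and "c \<ge> 0"
    and in1: "\<And>x y. x + c < y \<Longrightarrow> x + c < 0 \<Longrightarrow> P1 x y"
    and out1: "\<And>x y. y + c < x \<Longrightarrow> c < x \<Longrightarrow> \<not> P1 x y"
    and in2: "\<And>x y. y + c < x \<Longrightarrow> y + c < 0 \<Longrightarrow> P2 x y"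
    and out2: "\<And>x y. x + c < y \<Longrightarrow> c < y \<Longrightarrow> \<not> P2 x y"
    and in3: "\<And>x y. c < x \<Longrightarrow> c < y \<Longrightarrow> P3 x y"
    and out3: "\<And>x y. x + c < 0 \<Longrightarrow> y + c < 0 \<Longrightarrow> \<not> P3 x y"
  shows "\<exists>x y. P1 x y \<and> P2 x y \<and> P3 x y"
proof (rule ccontr)
  assume contra: "\<not> ?thesis"
  \<comment> \<open>The right end of the section of the first region at height \<open>y\<close>; by
    \<open>mono\<close> and openness the section is the open ray to its left.\<close>
  define \<alpha> where "\<alpha> y = Sup {x. P1 x y}" for y
  have ne: "{x. P1 x y} \<noteq> {}" for y
  proof -
    have "P1 (min y 0 - c - 1) y" by (rule in1) auto
    then show ?thesis by blast
  qed
  have bdd: "bdd_above {x. P1 x y}" for y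
  proof (rule bdd_aboveI[of _ "max y 0 + c"])
    fix x assume "x \<in> {x. P1 x y}"
    then have "\<not> (y + c < x \<and> c < x)" using out1[of y x] by blast
    then show "x \<le> max y 0 + c" by linarith
  qed
  have section_open: "open {x. Q x y}" if "open {z. Q (fst z) (snd z)}" for Q and y :: real
  proof -
    have "open ((\<lambda>x. (x, y)) -` {z. Q (fst z) (snd z)})"
      by (rule open_vimage[OF that]) (intro continuous_intros)
    then show ?thesis by simp
  qed
  have \<alpha>: "P1 x y \<longleftrightarrow> x < \<alpha> y" for x y
  proof
    assume "P1 x y"
    with section_open[OF open1, of y] obtain e where "e > 0" "\<And>x'. dist x' x < e \<Longrightarrow> P1 x' y"
      unfolding open_dist by auto
    then have "P1 (x + e / 2) y" by (simp add: dist_real_def)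
    then have "x + e / 2 \<le> \<alpha> y" unfolding \<alpha>_def by (intro cSup_upper bdd) auto
    with \<open>e > 0\<close> show "x < \<alpha> y" by linarith
  next
    assume "x < \<alpha> y"
    then obtain x' where "P1 x' y" "x < x'"
      unfolding \<alpha>_def using less_cSup_iff[OF ne bdd] by auto
    with mono show "P1 x y" by (meson less_imp_le order_refl)
  qed
  \<comment> \<open>Monotonicity in \<open>y\<close> gives the lower bound, invariance under
    diagonal shifts the upper one. So \<open>\<alpha>\<close> is 1-Lipschitz, and the boundary curve
    is continuous.\<close>
  have lip: "\<alpha> y \<le> \<alpha> y' \<and> \<alpha> y' \<le> \<alpha> y + (y' - y)" if "y \<le> y'" for y y'
  proof -
    have "\<not> P1 (\<alpha> y') y" using \<alpha>[of "\<alpha> y'" y'] mono[OF _ order_refl that] by blast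
    moreover have "\<not> P1 (\<alpha> y + (y' - y)) y'"
      using shift[of "\<alpha> y" "y' - y" y] \<alpha>[of "\<alpha> y" y] that by auto
    ultimately show ?thesis by (simp add: \<alpha>)
  qed
  have "dist (\<alpha> y) (\<alpha> y') \<le> dist y y'" for y y'
    using lip[of y y'] lip[of y' y] by (cases "y \<le> y'") (auto simp: dist_real_def)
  then have cont: "continuous_on UNIV \<alpha>"
    unfolding continuous_on_iff by (meson le_less_trans)
  have curve: "open {y. Q (\<alpha> y) y}" if "open {z. Q (fst z) (snd z)}" for Q
  proof -
    have "open ((\<lambda>y. (\<alpha> y, y)) -` {z. Q (fst z) (snd z)})"
      by (rule open_vimage[OF that]) (intro continuous_intros cont)
    then show ?thesis by simp
  qed
  \<comment> \<open>Points just left of the curve lie in the first region, so by openness a curve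
    point in both other regions would yield a common point of all three.\<close>
  have "\<not> (P2 (\<alpha> y) y \<and> P3 (\<alpha> y) y)" for y
  proof
    assume "P2 (\<alpha> y) y \<and> P3 (\<alpha> y) y"
    then have in23: "\<alpha> y \<in> {x. P2 x y} \<inter> {x. P3 x y}" by simp
    have "open ({x. P2 x y} \<inter> {x. P3 x y})"
      by (rule open_Int[OF section_open[OF open2] section_open[OF open3]])
    from bspec[OF this[unfolded open_dist] in23]
    obtain e where "e > 0" "\<And>x. dist x (\<alpha> y) < e \<Longrightarrow> P2 x y \<and> P3 x y"
      by auto
    then have "P2 (\<alpha> y - e / 2) y \<and> P3 (\<alpha> y - e / 2) y \<and> P1 (\<alpha> y - e / 2) y"
      by (simp add: dist_real_def \<alpha>)
    with contra show False by blast
  qed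
  then have "{y. P2 (\<alpha> y) y} \<inter> {y. P3 (\<alpha> y) y} \<inter> UNIV = {}" by auto
  moreover have cov: "P2 (\<alpha> y) y \<or> P3 (\<alpha> y) y" for y
    using cover[of "\<alpha> y" y] \<alpha>[of "\<alpha> y" y] by simp
  then have "UNIV \<subseteq> {y. P2 (\<alpha> y) y} \<union> {y. P3 (\<alpha> y) y}" by auto
  ultimately have "{y. P2 (\<alpha> y) y} = {} \<or> {y. P3 (\<alpha> y) y} = {}"
    using connectedD[OF connected_UNIV curve[OF open2] curve[OF open3]] by simp
  \<comment> \<open>The heights \<open>- (2 * c + 1)\<close> and \<open>2 * c + 1\<close> are so
    extreme that, wherever the curve is at that height, the asymptotic hypotheses force the second
    region at the low end and the third at the high end.\<close>
  moreover have "P2 (\<alpha> (- (2 * c + 1))) (- (2 * c + 1))"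
  proof (cases "\<alpha> (- (2 * c + 1)) + c < 0")
    case True
    then have "\<not> P3 (\<alpha> (- (2 * c + 1))) (- (2 * c + 1))"
      by (rule out3) (use \<open>c \<ge> 0\<close> in linarith)
    with cov show ?thesis by blast
  next
    case False
    show ?thesis by (rule in2) (use False \<open>c \<ge> 0\<close> in linarith)+
  qed
  moreover have "P3 (\<alpha> (2 * c + 1)) (2 * c + 1)"
  proof (cases "c < \<alpha> (2 * c + 1)")
    case True
    then show ?thesis by (rule in3) (use \<open>c \<ge> 0\<close> in linarith)
  next
    case False
    have "\<not> P2 (\<alpha> (2 * c + 1)) (2 * c + 1)"
      by (rule out2) (use False \<open>c \<ge> 0\<close> in linarith)+
    with cov show ?thesis by blast
  qed
  ultimately show False by blast
qed

text \<open>For each coordinate consider the region of potentials with more than \<open>k\<close>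
  bad points. If the three regions cover the plane of potentials, \<open>three_regions_meet\<close>
  gives the second alternative; a potential outside all of them gives the first.\<close>

lemma potential_dichotomy:
  fixes w :: "'n::finite \<Rightarrow> 3 \<Rightarrow> real" and S :: "'n \<Rightarrow> 3 set"
  shows "(\<exists>\<nu>. \<forall>r. card {j. \<exists>r'\<in>S j. w j r + \<nu> r < w j r' + \<nu> r'} \<le> k) \<or>
    (\<exists>\<nu>. \<forall>r. k < card {j. \<exists>r'\<in>S j. w j r + \<nu> r < w j r' + \<nu> r'})"
proof -
  define B where "B \<nu> r = {j. \<exists>r'\<in>S j. w j r + \<nu> r < w j r' + \<nu> r'}" for \<nu> r
  define C where "C = Max (range (\<lambda>(j, r). \<bar>w j r\<bar>))"
  have C: "\<bar>w j r\<bar> \<le> C" for j r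
    unfolding C_def by (rule Max_ge) (auto intro: range_eqI[of _ _ "(j, r)"])
  then have "C \<ge> 0" by (meson abs_ge_zero order_trans)
  have diff: "w j r - w j r' \<le> 2 * C" for j r r'
    using C[of j r] C[of j r'] by linarith
  have B_mono: "B \<nu> r \<subseteq> B \<nu>' r" if "\<And>r'. r' \<noteq> r \<Longrightarrow> \<nu> r' - \<nu> r \<le> \<nu>' r' - \<nu>' r" for \<nu> \<nu>' r
  proof
    fix j assume "j \<in> B \<nu> r"
    then obtain r' where r': "r' \<in> S j" "w j r + \<nu> r < w j r' + \<nu> r'" by (auto simp: B_def)
    then have "r' \<noteq> r" by auto
    with that[of r'] r' show "j \<in> B \<nu>' r" by (auto simp: B_def intro!: bexI[of _ r'])
  qed
  show ?thesis
  proof (cases "\<exists>r. card {j. \<not> S j \<subseteq> {r}} \<le> k")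
    \<comment> \<open>For all but at most \<open>k\<close> points, \<open>S j\<close> contains no
      coordinate other than \<open>r\<close>. Lowering \<open>\<nu> r\<close> beyond the spread
      \<open>2 * C\<close> of the weights makes \<open>r\<close> useless as a competitor, so only
      the exceptional points can be bad.\<close>
    case True
    then obtain r where r: "card {j. \<not> S j \<subseteq> {r}} \<le> k" by blast
    define \<nu> where "\<nu> x = (if x = r then - (2 * C + 1) else 0)" for x
    have "B \<nu> x \<subseteq> {j. \<not> S j \<subseteq> {r}}" for x
    proof
      fix j assume "j \<in> B \<nu> x"
      then obtain r' where r': "r' \<in> S j" "w j x + \<nu> x < w j r' + \<nu> r'" by (auto simp: B_def)
      then have "r' \<noteq> r"
        using diff[of j r x] by (auto simp: \<nu>_def split: if_splits)
      with r' show "j \<in> {j. \<not> S j \<subseteq> {r}}" by auto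
    qed
    then have "card (B \<nu> x) \<le> k" for x
      using r by (meson card_mono finite order_trans)
    then show ?thesis unfolding B_def by blast
  next
    case False
    \<comment> \<open>A coordinate of very low potential loses to any other element of
      \<open>S j\<close>; in the present case more than \<open>k\<close> points have one. This gives
      the hypotheses \<open>in1\<close>, \<open>in2\<close>, \<open>in3\<close> of the covering
      argument.\<close>
    have B_large: "k < card (B \<nu> r)" if "\<And>r'. r' \<noteq> r \<Longrightarrow> \<nu> r + 2 * C < \<nu> r'" for \<nu> r
    proof -
      have "{j. \<not> S j \<subseteq> {r}} \<subseteq> B \<nu> r"
      proof
        fix j assume "j \<in> {j. \<not> S j \<subseteq> {r}}"
        then obtain r' where "r' \<in> S j" "r' \<noteq> r" by auto
        with that[of r'] diff[of j r r'] show "j \<in> B \<nu> r"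
          by (auto simp: B_def intro!: bexI[of _ r'])
      qed
      then have "card {j. \<not> S j \<subseteq> {r}} \<le> card (B \<nu> r)" by (intro card_mono) auto
      with False show ?thesis by (meson not_le order_less_le_trans)
    qed
    \<comment> \<open>A coordinate of very high potential loses nowhere: the hypotheses
      \<open>out1\<close>, \<open>out2\<close>, \<open>out3\<close>.\<close>
    have B_empty: "\<not> k < card (B \<nu> r)" if "\<And>r'. r' \<noteq> r \<Longrightarrow> \<nu> r' + 2 * C < \<nu> r" for \<nu> r
    proof -
      have "B \<nu> r = {}"
      proof (rule ccontr)
        assume "B \<nu> r \<noteq> {}"
        then obtain j r' where r': "r' \<in> S j" "w j r + \<nu> r < w j r' + \<nu> r'" by (auto simp: B_def)
        then have "r' \<noteq> r" by auto
        with that[of r'] diff[of j r' r] r' show False by linarith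
      qed
      then show ?thesis by simp
    qed
    \<comment> \<open>Badness depends only on differences of potentials, so the third one is
      normalised to 0 and two parameters remain.\<close>
    define \<nu> where "\<nu> x y r = (if r = 1 then x else if r = 2 then y else 0)" for x y :: real and r :: 3
    have \<nu>: "\<nu> x y 1 = x" "\<nu> x y 2 = y" "\<nu> x y 3 = 0" for x y
      by (auto simp: \<nu>_def)
    \<comment> \<open>The region is a union, over sets \<open>K\<close> of more than
      \<open>k\<close> points, of finite intersections of unions of sets given by strict
      inequalities between continuous functions.\<close>
    have op: "open {z. k < card (B (\<nu> (fst z) (snd z)) r)}" for r
    proof -
      have "{z. k < card (B (\<nu> (fst z) (snd z)) r)} =
        (\<Union>K\<in>{K. k < card K}. \<Inter>j\<in>K. \<Union>r'\<in>S j.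
          {z. w j r + \<nu> (fst z) (snd z) r < w j r' + \<nu> (fst z) (snd z) r'})" (is "?L = ?R")
      proof
        show "?L \<subseteq> ?R"
        proof
          fix z assume "z \<in> ?L"
          then show "z \<in> ?R"
            by (intro UN_I[of "B (\<nu> (fst z) (snd z)) r"]) (auto simp: B_def)
        qed
        show "?R \<subseteq> ?L"
        proof
          fix z assume "z \<in> ?R"
          then obtain K where K: "k < card K" "K \<subseteq> B (\<nu> (fst z) (snd z)) r"
            by (auto simp: B_def)
          then have "card K \<le> card (B (\<nu> (fst z) (snd z)) r)" by (intro card_mono) auto
          with K show "z \<in> ?L" by auto
        qed
      qed
      moreover have "continuous_on UNIV (\<lambda>z. \<nu> (fst z) (snd z) r)" for r
        unfolding \<nu>_def by (cases "r = 1"; cases "r = 2") (auto intro!: continuous_intros)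
      then have "open {z. w j r + \<nu> (fst z) (snd z) r < w j r' + \<nu> (fst z) (snd z) r'}" for j r'
        by (intro open_Collect_less continuous_intros)
      ultimately show ?thesis
        by (auto intro!: open_UN open_INT)
    qed
    show ?thesis
    proof (rule disjCI)
      assume "\<not> (\<exists>\<nu>. \<forall>r. k < card {j. \<exists>r'\<in>S j. w j r + \<nu> r < w j r' + \<nu> r'})"
      then have none: "\<not> (\<exists>\<nu>. \<forall>r. k < card (B \<nu> r))" by (simp add: B_def)
      have 3: "(r' :: 3) = 1 \<or> r' = 2 \<or> r' = 3" for r'
        by (rule exhaust_3)
      have "\<exists>x y. \<not> (k < card (B (\<nu> x y) 1) \<or> k < card (B (\<nu> x y) 2) \<or> k < card (B (\<nu> x y) 3))"
      proof (rule ccontr)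
        assume "\<not> ?thesis"
        then have "\<And>x y. k < card (B (\<nu> x y) 1) \<or> k < card (B (\<nu> x y) 2) \<or> k < card (B (\<nu> x y) 3)"
          by blast
        then have "\<exists>x y. k < card (B (\<nu> x y) 1) \<and> k < card (B (\<nu> x y) 2) \<and> k < card (B (\<nu> x y) 3)"
        proof (rule three_regions_meet[where c = "2 * C"])
          show "k < card (B (\<nu> x' y') 1)"
            if "k < card (B (\<nu> x y) 1)" "x' \<le> x" "y \<le> y'" for x x' y y'
          proof -
            have "B (\<nu> x y) 1 \<subseteq> B (\<nu> x' y') 1"
              by (rule B_mono) (use that in \<open>auto simp: \<nu>_def\<close>)
            then have "card (B (\<nu> x y) 1) \<le> card (B (\<nu> x' y') 1)" by (intro card_mono) auto
            with that show ?thesis by simp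
          qed
          \<comment> \<open>Raising \<open>x\<close> and \<open>y\<close> together leaves the
            comparison of coordinates 1 and 2 unchanged and only weakens the third
            competitor.\<close>
          show "k < card (B (\<nu> x y) 1)" if "k < card (B (\<nu> (x + d) (y + d)) 1)" "d \<ge> 0" for x y d
          proof -
            have "B (\<nu> (x + d) (y + d)) 1 \<subseteq> B (\<nu> x y) 1"
              by (rule B_mono) (use that in \<open>auto simp: \<nu>_def\<close>)
            then have "card (B (\<nu> (x + d) (y + d)) 1) \<le> card (B (\<nu> x y) 1)"
              by (intro card_mono) auto
            with that show ?thesis by simp
          qed
          show "0 \<le> 2 * C" using \<open>C \<ge> 0\<close> by simp
        qed (rule op B_large B_empty; use 3 in \<open>auto simp: \<nu>_def\<close>)+
        with none show False unfolding forall_3 by blast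
      qed
      then obtain x y where "\<And>r. card (B (\<nu> x y) r) \<le> k"
        using forall_3[of "\<lambda>r. card (B (\<nu> x y) r) \<le> k" for x y] by (metis not_less)
      then show "\<exists>\<nu>. \<forall>r. card {j. \<exists>r'\<in>S j. w j r + \<nu> r < w j r' + \<nu> r'} \<le> k"
        unfolding B_def by blast
    qed
  qed
qed

section \<open>Leading terms along curves\<close>

text \<open>After division by \<open>s powr weight w t\<close> the terms other than \<open>t\<close>
  tend to 0, while the term \<open>t\<close> tends to its coefficient times the product of the
  nonzero limits. At variables not dividing \<open>t\<close> the limit \<open>c v\<close> may be
  0.\<close>

lemma eval_poly_eventually_nonzero:
  fixes f :: "('v::finite) cpoly" and x :: "real \<Rightarrow> 'v \<Rightarrow> complex"
  assumes lim: "\<And>v. ((\<lambda>s. x s v / of_real (s powr w v)) \<longlongrightarrow> c v) at_top"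
    and t: "t \<in> Poly_Mapping.keys f" "\<And>u. u \<in> Poly_Mapping.keys f \<Longrightarrow> u \<noteq> t \<Longrightarrow> weight w u < weight w t"
    and c: "\<And>v. v \<in> Poly_Mapping.keys t \<Longrightarrow> c v \<noteq> 0"
  shows "\<forall>\<^sub>F s in at_top. eval_poly (x s) f \<noteq> 0"
proof -
  let ?l = "Poly_Mapping.lookup"
  define y where "y s v = x s v / of_real (s powr w v)" for s v
  have mon: "monom_eval (x s) u = monom_eval (y s) u * of_real (s powr weight w u)" if "s > 0" for s u
  proof -
    have "s powr weight w u = (\<Prod>v\<in>UNIV. (s powr w v) ^ ?l u v)"
      using \<open>s > 0\<close> by (simp add: weight_def powr_sum powr_powr flip: powr_realpow)
    moreover have "monom_eval z u = (\<Prod>v\<in>UNIV. z v ^ ?l u v)" for z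
      by (rule monom_eval_superset) auto
    ultimately show ?thesis
      using \<open>s > 0\<close> by (simp add: y_def prod.distrib[symmetric] flip: power_mult_distrib)
  qed
  have lim_mon: "((\<lambda>s. monom_eval (y s) u) \<longlongrightarrow> monom_eval c u) at_top" for u
    unfolding monom_eval_def y_def by (intro tendsto_prod tendsto_power lim)
  have "((\<lambda>s. \<Sum>u\<in>Poly_Mapping.keys f. ?l f u * monom_eval (y s) u *
      of_real (s powr (weight w u - weight w t))) \<longlongrightarrow>
    (\<Sum>u\<in>Poly_Mapping.keys f. ?l f u * monom_eval c u * (if u = t then 1 else 0))) at_top"
  proof (intro tendsto_sum tendsto_mult tendsto_const lim_mon)
    fix u assume u: "u \<in> Poly_Mapping.keys f"
    show "((\<lambda>s. complex_of_real (s powr (weight w u - weight w t))) \<longlongrightarrow> (if u = t then 1 else 0)) at_top"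
    proof (cases "u = t")
      case True
      have "\<forall>\<^sub>F s in at_top. complex_of_real (s powr (weight w u - weight w t)) = 1"
        using eventually_gt_at_top[of 0] by eventually_elim (simp add: True)
      then show ?thesis using True by (auto intro: tendsto_eventually)
    next
      case False
      then have "((\<lambda>s. s powr (weight w u - weight w t)) \<longlongrightarrow> 0) at_top"
        using t(2)[OF u] by (intro tendsto_neg_powr filterlim_ident) auto
      from tendsto_of_real[OF this] show ?thesis using False by simp
    qed
  qed
  also have "(\<Sum>u\<in>Poly_Mapping.keys f. ?l f u * monom_eval c u * (if u = t then 1 else 0)) =
      ?l f t * monom_eval c t"
    using t(1) by (simp add: if_distrib cong: if_cong)
  finally have "((\<lambda>s. \<Sum>u\<in>Poly_Mapping.keys f. ?l f u * monom_eval (y s) u *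
      of_real (s powr (weight w u - weight w t))) \<longlongrightarrow> ?l f t * monom_eval c t) at_top" .
  moreover have "?l f t * monom_eval c t \<noteq> 0"
    using t(1) c by (simp add: monom_eval_def in_keys_iff)
  ultimately have "\<forall>\<^sub>F s in at_top. (\<Sum>u\<in>Poly_Mapping.keys f. ?l f u * monom_eval (y s) u *
      of_real (s powr (weight w u - weight w t))) \<noteq> 0"
    by (rule tendsto_imp_eventually_ne)
  then show ?thesis using eventually_gt_at_top[of 0]
  proof eventually_elim
    case (elim s)
    have "eval_poly (x s) f = (\<Sum>u\<in>Poly_Mapping.keys f. ?l f u * monom_eval (y s) u *
      of_real (s powr (weight w u - weight w t))) * of_real (s powr weight w t)"
      using \<open>s > 0\<close> unfolding eval_poly_superset[OF finite_keys subset_refl] sum_distrib_right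
      by (intro sum.cong refl) (simp add: mon powr_diff field_simps)
    with elim show ?case by simp
  qed
qed

section \<open>Points in general position\<close>

text \<open>Bilinear without conjugation, matching \<open>coplanar_points\<close>: for vectors in
  \<open>complex^4\<close>, \<open>h\<close> is a plane equation and \<open>x\<close> a
  point.\<close>

definition pairing :: "complex^'k \<Rightarrow> complex^'k \<Rightarrow> complex" where
  "pairing h x = (\<Sum>c\<in>UNIV. h $ c * x $ c)"

lemma pairing_add: "pairing (g + h) x = pairing g x + pairing h x"
  by (simp add: pairing_def distrib_right sum.distrib)

lemma pairing_scale: "pairing (a *s h) x = a * pairing h x"
  by (simp add: pairing_def sum_distrib_left mult_ac)

lemma pairing_zero [simp]: "pairing 0 x = 0"
  by (simp add: pairing_def)

lemma pairing_sum: "pairing (sum h A) x = (\<Sum>a\<in>A. pairing (h a) x)"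
  by (induction A rule: infinite_finite_induct) (simp_all add: pairing_add pairing_zero)

lemma matrix_vector_mult_pairing: "(A *v x) $ r = pairing (A $ r) x"
  by (simp add: matrix_vector_mult_def pairing_def)

lemma coplanar_points_pairing:
  "coplanar_points X \<longleftrightarrow> (\<exists>h. h \<noteq> 0 \<and> (\<forall>x\<in>X. pairing h x = 0))"
  by (simp add: coplanar_points_def pairing_def)

text \<open>The matrix with the four points as rows is invertible, since a kernel vector would be a
  plane through all of them.\<close>

lemma pairing_interpolation:
  assumes "card J = 4" "\<not> coplanar_points (q ` J)"
  shows "\<exists>h. \<forall>j\<in>J. pairing h (q j) = y j"
proof -
  have "finite J" using assms(1) by (metis card.infinite zero_neq_numeral)
  then obtain \<iota> :: "4 \<Rightarrow> _" where \<iota>: "bij_betw \<iota> UNIV J"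
    using finite_same_card_bij[of "UNIV :: 4 set" J] assms(1) by auto
  define M :: "complex^4^4" where "M = (\<chi> a. q (\<iota> a))"
  have comm: "pairing g h = pairing h g" for g h :: "complex^4"
    by (simp add: pairing_def mult.commute)
  have M: "(M *v h) $ a = pairing h (q (\<iota> a))" for h a
    by (simp add: matrix_vector_mult_pairing M_def comm)
  have "h = 0" if "M *v h = 0" for h
  proof -
    have "pairing h x = 0" if "x \<in> q ` J" for x
    proof -
      from that \<iota> obtain a where "x = q (\<iota> a)" by (auto simp: bij_betw_def)
      with M[of h a] \<open>M *v h = 0\<close> show ?thesis by simp
    qed
    with assms(2) show ?thesis unfolding coplanar_points_pairing by blast
  qed
  then have "\<exists>B. B ** M = Finite_Cartesian_Product.mat 1"
    unfolding matrix_left_invertible_ker by blast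
  then obtain B where "B ** M = Finite_Cartesian_Product.mat 1" ..
  then have "M ** B = Finite_Cartesian_Product.mat 1"
    using matrix_left_right_inverse by blast
  then have "M *v (B *v (\<chi> a. y (\<iota> a))) = (\<chi> a. y (\<iota> a))"
    by (simp add: matrix_vector_mul_assoc)
  with M have *: "pairing (B *v (\<chi> a. y (\<iota> a))) (q (\<iota> a)) = y (\<iota> a)" for a
    by (metis vec_lambda_beta)
  show ?thesis
  proof (intro exI ballI)
    fix j assume "j \<in> J"
    with \<iota> obtain a where "j = \<iota> a" by (auto simp: bij_betw_def)
    with * show "pairing (B *v (\<chi> a. y (\<iota> a))) (q j) = y j" by simp
  qed
qed

text \<open>Pad \<open>D\<close> to a set \<open>E\<close> of three points. A functional
  \<open>b\<close> vanishing on \<open>E\<close> vanishes at no further point, by non-coplanarity;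
  \<open>d\<close> separates \<open>D\<close> from the rest of \<open>E\<close>; then
  \<open>\<kappa> *s b + d\<close> has exactly the required zeros for all but finitely many
  \<open>\<kappa>\<close>.\<close>

lemma normal_vector_exists:
  fixes q :: "'n::finite \<Rightarrow> complex^4"
  assumes q: "\<And>J. card J = 4 \<Longrightarrow> \<not> coplanar_points (q ` J)" and n: "CARD('n) \<ge> 4"
    and D: "card D \<le> 3"
  shows "\<exists>b. \<forall>j. pairing b (q j) = 0 \<longleftrightarrow> j \<in> D"
proof -
  obtain E where E: "D \<subseteq> E" "card E = 3"
    using exists_subset_between[of D 3 UNIV] D n by auto
  have "E \<noteq> UNIV" using E n by auto
  then obtain j0 where j0: "j0 \<notin> E" by blast
  have card4: "card (insert j E) = 4" if "j \<notin> E" for j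
    using that E by simp
  obtain b where b: "\<forall>j\<in>insert j0 E. pairing b (q j) = (if j = j0 then 1 else 0)"
    using pairing_interpolation[where y = "\<lambda>j. if j = j0 then 1 else 0", OF card4[OF j0] q[OF card4[OF j0]]]
    by blast
  have b0: "pairing b (q j) \<noteq> 0" if "j \<notin> E" for j
  proof
    assume "pairing b (q j) = 0"
    moreover have "pairing b (q j) = 0" if "j \<in> E" for j using b that j0 by auto
    moreover have "b \<noteq> 0" using b by (auto simp: pairing_def)
    ultimately have "coplanar_points (q ` insert j E)"
      unfolding coplanar_points_pairing by (intro exI[of _ b]) auto
    with q card4[OF that] show False by blast
  qed
  obtain d where d: "\<forall>j\<in>insert j0 E. pairing d (q j) = (if j \<in> D then 0 else 1)"
    using pairing_interpolation[where y = "\<lambda>j. if j \<in> D then 0 else 1", OF card4[OF j0] q[OF card4[OF j0]]]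
    by blast
  have "finite ((\<lambda>j. - pairing d (q j) / pairing b (q j)) ` UNIV)" by simp
  then obtain \<kappa> where \<kappa>: "\<kappa> \<notin> (\<lambda>j. - pairing d (q j) / pairing b (q j)) ` UNIV"
    using ex_new_if_finite[OF infinite_UNIV_char_0] by blast
  have "pairing (\<kappa> *s b + d) (q j) = 0 \<longleftrightarrow> j \<in> D" for j
  proof (cases "j \<in> E")
    case True
    with b j0 have "pairing b (q j) = 0" by auto
    with True d show ?thesis by (auto simp: pairing_add pairing_scale)
  next
    case False
    have "\<kappa> \<noteq> - pairing d (q j) / pairing b (q j)" using \<kappa> by blast
    then have "\<kappa> * pairing b (q j) \<noteq> - pairing d (q j)"
      using b0[OF False] by (simp add: field_simps)
    with False E(1) show ?thesis by (auto simp: pairing_add pairing_scale eq_neg_iff_add_eq_0)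
  qed
  then show ?thesis by blast
qed

text \<open>Interpolation on four points containing \<open>D\<close>. These vectors adjust a camera
  row at one point of \<open>D\<close> without affecting the other points of
  \<open>D\<close>.\<close>

lemma dual_vectors_exist:
  fixes q :: "'n::finite \<Rightarrow> complex^4"
  assumes q: "\<And>J. card J = 4 \<Longrightarrow> \<not> coplanar_points (q ` J)" and n: "CARD('n) \<ge> 4"
    and D: "card D \<le> 3"
  shows "\<exists>d. \<forall>j\<in>D. \<forall>j'\<in>D. pairing (d j) (q j') = (if j = j' then 1 else 0)"
proof -
  obtain E where E: "D \<subseteq> E" "card E = 4"
    using exists_subset_between[of D 4 UNIV] D n by auto
  have "\<exists>h. \<forall>j'\<in>E. pairing h (q j') = (if j = j' then 1 else 0)" for j
    by (rule pairing_interpolation[OF E(2) q[OF E(2)]])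
  then obtain d where "\<And>j j'. j' \<in> E \<Longrightarrow> pairing (d j) (q j') = (if j = j' then 1 else 0)"
    by metis
  with E(1) show ?thesis by blast
qed

text \<open>Row \<open>r\<close> of the camera is a normal vector of the (at most three) bad points, of order
  \<open>s powr (- \<nu> r)\<close>, plus dual vectors that give the coordinate \<open>r\<close> the prescribed lower order at the
  bad points.\<close>

lemma camera_family_exists:
  fixes q :: "'n::finite \<Rightarrow> complex^4" and w :: "'n \<Rightarrow> 3 \<Rightarrow> real" and S :: "'n \<Rightarrow> 3 set"
  assumes q: "\<And>J. card J = 4 \<Longrightarrow> \<not> coplanar_points (q ` J)" and n: "CARD('n) \<ge> 4"
    and \<nu>: "\<And>r. card {j. \<exists>r'\<in>S j. w j r + \<nu> r < w j r' + \<nu> r'} \<le> 3"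
  shows "\<exists>(A :: real \<Rightarrow> complex^4^3) p c. (\<forall>\<^sub>F s in at_top. \<forall>j. same_point (A s *v q j) (p s j)) \<and>
    (\<forall>j r. ((\<lambda>s. p s j $ r / of_real (s powr w j r)) \<longlongrightarrow> c j r) at_top) \<and>
    (\<forall>j. \<forall>r\<in>S j. c j r \<noteq> 0)"
proof -
  define D where "D r = {j. \<exists>r'\<in>S j. w j r + \<nu> r < w j r' + \<nu> r'}" for r
  \<comment> \<open>\<open>l j\<close> is the largest adjusted weight over \<open>S j\<close>, so
    \<open>j\<close> is bad for \<open>r\<close> exactly when \<open>r\<close> stays strictly below
    it. For empty \<open>S j\<close> the minimum over all coordinates is taken, which makes
    \<open>j\<close> bad for none.\<close>
  have "\<exists>l. (\<forall>r. j \<in> D r \<longleftrightarrow> w j r + \<nu> r < l) \<and> (\<forall>r\<in>S j. w j r + \<nu> r \<le> l)" for j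
  proof (cases "S j = {}")
    case True
    have "Min (range (\<lambda>r. w j r + \<nu> r)) \<le> w j r + \<nu> r" for r
      by (rule Min_le) auto
    with True show ?thesis
      by (intro exI[of _ "Min (range (\<lambda>r. w j r + \<nu> r))"]) (auto simp: D_def not_less)
  next
    case False
    then show ?thesis
      by (intro exI[of _ "Max ((\<lambda>r. w j r + \<nu> r) ` S j)"]) (auto simp: D_def Max_gr_iff)
  qed
  then obtain l where l: "\<And>j r. j \<in> D r \<longleftrightarrow> w j r + \<nu> r < l j" "\<And>j r. r \<in> S j \<Longrightarrow> w j r + \<nu> r \<le> l j"
    by metis
  have D: "card (D r) \<le> 3" for r using \<nu> by (simp add: D_def)
  obtain b where b: "\<And>r j. pairing (b r) (q j) = 0 \<longleftrightarrow> j \<in> D r"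
    using normal_vector_exists[OF q n D] by metis
  have "\<forall>r. \<exists>d. \<forall>j\<in>D r. \<forall>j'\<in>D r. pairing (d j) (q j') = (if j = j' then 1 else 0)"
    using dual_vectors_exist[OF q n D] by blast
  then obtain d where d: "\<And>r j j'. j \<in> D r \<Longrightarrow> j' \<in> D r \<Longrightarrow>
      pairing (d r j) (q j') = (if j = j' then 1 else 0)"
    by metis
  define A :: "real \<Rightarrow> complex^4^3" where
    "A s = (\<chi> r. of_real (s powr (- \<nu> r)) *s b r +
      (\<Sum>j\<in>D r. of_real (s powr (w j r - l j)) *s d r j))" for s
  \<comment> \<open>\<open>v j r\<close> is the order of growth of coordinate \<open>r\<close> of
    \<open>A s *v q j\<close>, and \<open>g j r\<close> its leading coefficient.\<close>
  define v where "v j r = (if j \<in> D r then w j r - l j else - \<nu> r)" for j r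
  define g where "g j r = (if j \<in> D r then 1 else pairing (b r) (q j))" for j r
  have g0: "g j r \<noteq> 0" for j r by (simp add: g_def b)
  have Aq: "(A s *v q j) $ r = of_real (s powr (- \<nu> r)) * pairing (b r) (q j) +
      (\<Sum>j'\<in>D r. of_real (s powr (w j' r - l j')) * pairing (d r j') (q j))" for s j r
    by (simp add: matrix_vector_mult_pairing A_def pairing_add pairing_scale pairing_sum)
  have lim: "((\<lambda>s. (A s *v q j) $ r / of_real (s powr v j r)) \<longlongrightarrow> g j r) at_top" for j r
  proof (cases "j \<in> D r")
    case True
    have "(A s *v q j) $ r = of_real (s powr v j r)" for s
    proof -
      have "(\<Sum>j'\<in>D r. of_real (s powr (w j' r - l j')) * pairing (d r j') (q j)) =
        (\<Sum>j'\<in>D r. if j' = j then of_real (s powr (w j r - l j)) else 0)"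
        by (rule sum.cong) (use d True in auto)
      with True b show ?thesis by (simp add: Aq v_def)
    qed
    moreover have "\<forall>\<^sub>F s in at_top. complex_of_real (s powr v j r) / of_real (s powr v j r) = 1"
      using eventually_gt_at_top[of 0] by eventually_elim simp
    ultimately show ?thesis
      using True by (simp add: g_def tendsto_eventually)
  next
    case False
    \<comment> \<open>Relative to \<open>s powr (- \<nu> r)\<close> the dual vectors carry the
      exponents \<open>w j' r - l j' + \<nu> r\<close>, negative by the definition of badness. So
      they do not disturb the leading term at good points.\<close>
    have "((\<lambda>s. pairing (b r) (q j) + (\<Sum>j'\<in>D r. of_real (s powr (w j' r - l j' + \<nu> r)) *
        pairing (d r j') (q j))) \<longlongrightarrow> pairing (b r) (q j) + (\<Sum>j'\<in>D r. of_real 0 * pairing (d r j') (q j))) at_top"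
    proof (intro tendsto_add tendsto_const tendsto_sum tendsto_mult tendsto_of_real)
      fix j' assume "j' \<in> D r"
      then show "((\<lambda>s. s powr (w j' r - l j' + \<nu> r)) \<longlongrightarrow> 0) at_top"
        using l(1)[of j' r] by (intro tendsto_neg_powr filterlim_ident) auto
    qed
    moreover have "\<forall>\<^sub>F s in at_top. pairing (b r) (q j) + (\<Sum>j'\<in>D r. of_real (s powr (w j' r - l j' + \<nu> r)) *
        pairing (d r j') (q j)) = (A s *v q j) $ r / of_real (s powr v j r)"
      using eventually_gt_at_top[of 0]
    proof eventually_elim
      case (elim s)
      have inv: "x / of_real (s powr - \<nu> r) = x * of_real (s powr \<nu> r)" for x :: complex
        by (simp add: powr_minus divide_inverse)
      have "of_real (s powr - \<nu> r) * of_real (s powr \<nu> r) = (1 :: complex)"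
        using elim by (simp flip: of_real_mult powr_add)
      then have "of_real (s powr - \<nu> r) * x * of_real (s powr \<nu> r) = x" for x :: complex
        by (metis mult.assoc mult.commute mult_1)
      moreover have "(\<Sum>j'\<in>D r. of_real (s powr (w j' r - l j' + \<nu> r)) * pairing (d r j') (q j)) =
        (\<Sum>j'\<in>D r. of_real (s powr (w j' r - l j')) * pairing (d r j') (q j)) * of_real (s powr \<nu> r)"
        unfolding sum_distrib_right
        by (rule sum.cong) (simp_all add: powr_add)
      ultimately show ?case
        using False by (simp add: Aq v_def inv distrib_right)
    qed
    ultimately show ?thesis
      using False by (simp add: g_def tendsto_cong)
  qed
  \<comment> \<open>Scaling by \<open>s powr l j\<close> keeps the image point and turns the order
    into \<open>l j + v j r\<close>. This equals \<open>w j r\<close> at bad points, is at most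
    \<open>w j r\<close> at good ones, and equals it whenever \<open>r\<close> is in
    \<open>S j\<close>.\<close>
  define p :: "real \<Rightarrow> 'n \<Rightarrow> complex^3" where "p s j = of_real (s powr l j) *s (A s *v q j)" for s j
  have nonzero: "\<forall>\<^sub>F s in at_top. A s *v q j \<noteq> 0" for j
  proof -
    have "\<forall>\<^sub>F s in at_top. (A s *v q j) $ 1 / of_real (s powr v j 1) \<noteq> 0"
      by (rule tendsto_imp_eventually_ne[OF lim g0])
    then show ?thesis by eventually_elim auto
  qed
  have "\<forall>\<^sub>F s in at_top. \<forall>j. same_point (A s *v q j) (p s j)"
  proof (rule eventually_all_finite)
    fix j
    show "\<forall>\<^sub>F s in at_top. same_point (A s *v q j) (p s j)"
      using nonzero[of j] eventually_gt_at_top[of 0]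
    proof eventually_elim
      case (elim s)
      then have "p s j \<noteq> 0"
        by (simp add: p_def)
      moreover have "A s *v q j = of_real (1 / (s powr l j)) *s p s j"
        using elim by (simp add: p_def vector_smult_assoc)
      ultimately show ?case
        unfolding same_point_def using elim by blast
    qed
  qed
  moreover have "((\<lambda>s. p s j $ r / of_real (s powr w j r)) \<longlongrightarrow>
    (if l j + v j r = w j r then g j r else 0)) at_top" for j r
  proof -
    have "((\<lambda>s. of_real (s powr (l j + v j r - w j r)) * ((A s *v q j) $ r / of_real (s powr v j r))) \<longlongrightarrow>
      (of_real (if l j + v j r = w j r then 1 else 0)) * g j r) at_top"
    proof (intro tendsto_mult lim tendsto_of_real)
      have "l j + v j r \<le> w j r" using l(1)[of j r] by (auto simp: v_def)
      then show "((\<lambda>s. s powr (l j + v j r - w j r)) \<longlongrightarrow> (if l j + v j r = w j r then 1 else 0)) at_top"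
      proof (cases "l j + v j r = w j r")
        case True
        have "\<forall>\<^sub>F s in at_top. s powr (l j + v j r - w j r) = 1"
          using eventually_gt_at_top[of 0] by eventually_elim (simp add: True)
        with True show ?thesis by (simp add: tendsto_eventually)
      next
        case False
        with \<open>l j + v j r \<le> w j r\<close> show ?thesis
          by (auto intro!: tendsto_neg_powr filterlim_ident)
      qed
    qed
    moreover have "\<forall>\<^sub>F s in at_top. of_real (s powr (l j + v j r - w j r)) * ((A s *v q j) $ r / of_real (s powr v j r)) =
      p s j $ r / of_real (s powr w j r)"
      using eventually_gt_at_top[of 0]
      by eventually_elim (simp add: p_def powr_add powr_diff)
    ultimately show ?thesis by (auto simp: tendsto_cong)
  qed
  moreover have "l j + v j r = w j r" if "r \<in> S j" for j r
    using l(1)[of j r] l(2)[OF that] by (auto simp: v_def)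
  ultimately show ?thesis
    using g0 by (intro exI[of _ A] exI[of _ p] exI[of _ "\<lambda>j r. if l j + v j r = w j r then g j r else 0"]) auto
qed

section \<open>The resectioning variety\<close>

lemma eval_poly_tendsto:
  assumes "\<And>v. ((\<lambda>s. x s v) \<longlongrightarrow> y v) F"
  shows "((\<lambda>s. eval_poly (x s) f) \<longlongrightarrow> eval_poly y f) F"
  unfolding eval_poly_def by (intro tendsto_sum tendsto_mult tendsto_const tendsto_prod tendsto_power assms)

section \<open>Multidegrees of monomials\<close>

definition blk_degree :: "('v \<Rightarrow> 'b) \<Rightarrow> 'v monomial \<Rightarrow> 'b \<Rightarrow> nat" where
  "blk_degree blk t b = (\<Sum>v\<in>{v \<in> Poly_Mapping.keys t. blk v = b}. Poly_Mapping.lookup t v)"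

lemma multihomogeneousI:
  assumes "\<And>t. t \<in> Poly_Mapping.keys f \<Longrightarrow> blk_degree blk t = d"
  shows "multihomogeneous blk f"
  unfolding multihomogeneous_def using assms by (auto simp: blk_degree_def fun_eq_iff)

lemma blk_degree_superset:
  assumes "finite K" "Poly_Mapping.keys t \<subseteq> K"
  shows "blk_degree blk t b = (\<Sum>v\<in>{v \<in> K. blk v = b}. Poly_Mapping.lookup t v)"
  unfolding blk_degree_def
  by (rule sum.mono_neutral_left) (use assms in \<open>auto simp: in_keys_iff\<close>)

lemma blk_degree_add: "blk_degree blk (s + t) b = blk_degree blk s b + blk_degree blk t b"
proof -
  let ?K = "Poly_Mapping.keys s \<union> Poly_Mapping.keys t"
  have "finite ?K" "Poly_Mapping.keys (s + t) \<subseteq> ?K"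
    using Poly_Mapping.keys_add[of s t] by auto
  then show ?thesis
    by (simp add: blk_degree_superset[of ?K] lookup_add sum.distrib)
qed

lemma blk_degree_0 [simp]: "blk_degree blk 0 b = 0"
  by (simp add: blk_degree_def)

lemma blk_degree_single [simp]:
  "blk_degree blk (Poly_Mapping.single v (Suc 0)) b = (if blk v = b then 1 else 0)"
proof -
  have "{u \<in> {v}. blk u = b} = (if blk v = b then {v} else {})" by auto
  then show ?thesis by (simp add: blk_degree_superset[of "{v}"])
qed

lemma blk_degree_sum: "blk_degree blk (sum f A) b = (\<Sum>a\<in>A. blk_degree blk (f a) b)"
  by (induction A rule: infinite_finite_induct) (auto simp: blk_degree_add)

lemma ifc_coords_multiproj:
  fixes A :: "'m \<Rightarrow> complex^4^3" and q :: "'n \<Rightarrow> complex^4" and p :: "'m \<Rightarrow> 'n \<Rightarrow> complex^3"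
  shows "ifc_coords A q p \<in> multiproj_coords ifc_blk \<longleftrightarrow>
    (\<forall>i. A i \<noteq> 0) \<and> (\<forall>j. q j \<noteq> 0) \<and> (\<forall>i j. p i j \<noteq> 0)" (is "?L \<longleftrightarrow> ?R")
proof
  assume L: ?L
  then have *: "\<exists>v. ifc_blk v = ifc_blk u \<and> ifc_coords A q p v \<noteq> 0" for u
    by (simp add: multiproj_coords_def)
  have "A i \<noteq> 0" for i
  proof -
    obtain v where "ifc_blk v = CamB i" "ifc_coords A q p v \<noteq> 0" using *[of "CamV i 0 0"] by auto
    then show ?thesis by (cases v) auto
  qed
  moreover have "q j \<noteq> 0" for j
  proof -
    obtain v where "ifc_blk v = PtB j" "ifc_coords A q p v \<noteq> 0" using *[of "PtV j 0"] by auto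
    then show ?thesis by (cases v) auto
  qed
  moreover have "p i j \<noteq> 0" for i j
  proof -
    obtain v where "ifc_blk v = ImgB i j" "ifc_coords A q p v \<noteq> 0" using *[of "ImgV i j 0"] by auto
    then show ?thesis by (cases v) auto
  qed
  ultimately show ?R by blast
next
  assume R: ?R
  have "\<exists>v. ifc_blk v = ifc_blk u \<and> ifc_coords A q p v \<noteq> 0" for u
  proof (cases u)
    case (CamV i r c)
    have "A i \<noteq> 0" using R by blast
    then obtain r c where "A i $ r $ c \<noteq> 0" by (auto simp: Finite_Cartesian_Product.vec_eq_iff)
    then show ?thesis using CamV by (intro exI[of _ "CamV i r c"]) auto
  next
    case (PtV j c)
    have "q j \<noteq> 0" using R by blast
    then obtain c where "q j $ c \<noteq> 0" by (auto simp: Finite_Cartesian_Product.vec_eq_iff)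
    then show ?thesis using PtV by (intro exI[of _ "PtV j c"]) auto
  next
    case (ImgV i j r)
    have "p i j \<noteq> 0" using R by blast
    then obtain r where "p i j $ r \<noteq> 0" by (auto simp: Finite_Cartesian_Product.vec_eq_iff)
    then show ?thesis using ImgV by (intro exI[of _ "ImgV i j r"]) auto
  qed
  then show ?L by (auto simp: multiproj_coords_def)
qed

lemma resectioning_varietyI:
  fixes A :: "'m \<Rightarrow> complex^4^3" and q :: "'n \<Rightarrow> complex^4"
  assumes "\<And>i j. same_point (A i *v q j) (p i j)"
  shows "p \<in> resectioning_variety q"
proof -
  have A: "A i \<noteq> 0" "q j \<noteq> 0" "p i j \<noteq> 0" for i j
    using assms[of i j] by (auto simp: same_point_def)
  then have "ifc_coords A q p \<in> multiproj_coords ifc_blk"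
    by (simp add: ifc_coords_multiproj)
  then have "(A, q, p) \<in> image_formation"
    unfolding image_formation_def zariski_closure_def using assms A by blast
  then show ?thesis by (auto simp: resectioning_variety_def)
qed

text \<open>The bilinear relations expressing \<open>A i *v q j \<and> p i j = 0\<close> survive in the closure.\<close>

lemma resectioning_varietyD:
  fixes q :: "'n \<Rightarrow> complex^4" and p :: "'m \<Rightarrow> 'n \<Rightarrow> complex^3"
  assumes "p \<in> resectioning_variety q"
  obtains A c where "\<And>i. A i \<noteq> 0" "\<And>i j. p i j \<noteq> 0" "\<And>i j. A i *v q j = c i j *s p i j"
proof -
  define X :: "(('m, 'n) ifc_var \<Rightarrow> complex) set" where
    "X = {ifc_coords A q p | A q p. (\<forall>i. A i \<noteq> 0) \<and> (\<forall>j. q j \<noteq> 0) \<and> (\<forall>i j. p i j \<noteq> 0) \<and>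
      (\<forall>i j. same_point (A i *v q j) (p i j))}"
  obtain A where A: "ifc_coords A q p \<in> zariski_closure ifc_blk X"
    using assms by (auto simp: resectioning_variety_def image_formation_def X_def)
  then have "ifc_coords A q p \<in> multiproj_coords ifc_blk"
    by (simp add: zariski_closure_def)
  then have nz: "\<And>i. A i \<noteq> 0" "\<And>i j. p i j \<noteq> 0"
    by (auto simp: ifc_coords_multiproj)
  have rel: "p i j $ a * (A i *v q j) $ b = p i j $ b * (A i *v q j) $ a" for i j a b
  proof -
    \<comment> \<open>A 2 by 2 minor of the matrix with columns \<open>p i j\<close> and
      \<open>A i *v q j\<close>; it has degree 1 in each of the three blocks involved.\<close>
    define F :: "('m, 'n) ifc_var cpoly" where
      "F = (\<Sum>k\<in>UNIV. Var (ImgV i j a) * Var (CamV i b k) * Var (PtV j k) -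
        Var (ImgV i j b) * Var (CamV i a k) * Var (PtV j k))"
    have eval: "eval_poly (ifc_coords A q p) F = p i j $ a * (A i *v q j) $ b - p i j $ b * (A i *v q j) $ a"
      for A q p
      unfolding F_def eval_poly_sum eval_poly.hom_minus eval_poly_mult eval_poly_Var ifc_coords.simps
        matrix_vector_mult_def vec_lambda_beta sum_subtractf sum_distrib_left
      by (simp only: mult.assoc)
    have "multihomogeneous ifc_blk F"
    proof (rule multihomogeneousI)
      fix t assume t: "t \<in> Poly_Mapping.keys F"
      define m where "m a b k = Poly_Mapping.single (ImgV i j a) 1 + Poly_Mapping.single (CamV i b k) 1 +
          Poly_Mapping.single (PtV j k) (1 :: nat)" for a b k
      have "F = (\<Sum>k\<in>UNIV. Poly_Mapping.single (m a b k) 1 - Poly_Mapping.single (m b a k) 1)"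
        by (simp add: F_def Var_def mult_single m_def)
      then have "Poly_Mapping.keys F \<subseteq>
          (\<Union>k. Poly_Mapping.keys (Poly_Mapping.single (m a b k) 1 - Poly_Mapping.single (m b a k) (1 :: complex)))"
        by (simp add: keys_sum)
      also have "\<dots> \<subseteq> (\<Union>k. {m a b k, m b a k})"
        by (intro UN_mono order_trans[OF keys_diff]) auto
      finally obtain k where "t = m a b k \<or> t = m b a k"
        using t by blast
      then show "blk_degree ifc_blk t = (\<lambda>c. (if c = ImgB i j then 1 else 0) +
          (if c = CamB i then 1 else 0) + (if c = PtB j then 1 else 0))"
        by (auto simp: fun_eq_iff blk_degree_add m_def)
    qed
    moreover have "\<forall>x\<in>X. eval_poly x F = 0"
    proof
      fix x assume "x \<in> X"
      then obtain A q p where x: "x = ifc_coords A q p" "same_point (A i *v q j) (p i j)"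
        unfolding X_def by blast
      then obtain c where "A i *v q j = c *s p i j" unfolding same_point_def by blast
      then show "eval_poly x F = 0" by (simp add: eval x)
    qed
    ultimately have "eval_poly (ifc_coords A q p) F = 0"
      using A by (simp add: zariski_closure_def)
    then show ?thesis by (simp add: eval)
  qed
  \<comment> \<open>The factor may be 0: in the closure, \<open>q j\<close> can be the centre of
    camera \<open>i\<close>.\<close>
  have "\<exists>c. A i *v q j = c *s p i j" for i j
  proof -
    obtain a where a: "p i j $ a \<noteq> 0"
      using nz(2)[of i j] by (auto simp: Finite_Cartesian_Product.vec_eq_iff)
    have "A i *v q j = ((A i *v q j) $ a / p i j $ a) *s p i j"
      unfolding Finite_Cartesian_Product.vec_eq_iff
    proof
      fix b
      show "(A i *v q j) $ b = (((A i *v q j) $ a / p i j $ a) *s p i j) $ b"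
        using rel[of i j a b] a by (simp add: field_simps)
    qed
    then show ?thesis ..
  qed
  then obtain c where "\<And>i j. A i *v q j = c i j *s p i j" by metis
  with nz that show ?thesis by blast
qed

text \<open>The perturbed points are the rows of \<open>s\<^sup>-\<^sup>1 (1 + s Q)\<close>.\<close>

lemma eventually_perturbation_independent:
  fixes q :: "'n::finite \<Rightarrow> complex^4"
  assumes \<iota>: "inj (\<iota> :: 'n \<Rightarrow> 4)"
  shows "\<forall>\<^sub>F s in at_top. \<forall>y. \<exists>h. \<forall>j. pairing h (q j + axis (\<iota> j) (of_real (1 / s))) = y j"
proof -
  \<comment> \<open>With fewer than four points the remaining rows are 0, so \<open>N x\<close> is
    square and has unit rows there.\<close>
  define Q :: "complex^4^4" where "Q = (\<chi> a. if a \<in> range \<iota> then q (inv_into UNIV \<iota> a) else 0)"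
  define N where "N x = (\<chi> a b. (if a = b then 1 else 0) + x * Q $ a $ b)" for x
  \<comment> \<open>The determinant of \<open>N x\<close> as a polynomial in \<open>x\<close>. Its
    value at 0 is 1, so it has finitely many roots and \<open>N\<close> is invertible for all large
    arguments.\<close>
  define P where "P = Determinants.det (\<chi> a b. [:if a = b then 1 else 0, Q $ a $ b:])"
  have P: "poly P x = Determinants.det (N x)" for x
    by (simp add: P_def Determinants.det_def N_def poly_sum poly_prod)
  have "N 0 = Finite_Cartesian_Product.mat 1"
    by (simp add: N_def Finite_Cartesian_Product.mat_def)
  then have "poly P 0 = 1" by (simp add: P)
  then have "P \<noteq> 0" by auto
  then have fin: "finite {x. poly P x = 0}" by (rule poly_roots_finite)
  from finite_imp_bounded[OF this] obtain B where B: "\<And>x. poly P x = 0 \<Longrightarrow> norm x \<le> B"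
    unfolding bounded_iff by auto
  have "\<forall>y. \<exists>h. \<forall>j. pairing h (q j + axis (\<iota> j) (of_real (1 / s))) = y j" if s: "s > max 0 B" for s
  proof
    fix y :: "'n \<Rightarrow> complex"
    have "poly P (of_real s) \<noteq> 0" using B[of "of_real s"] s by auto
    then have "invertible (N (of_real s))" by (simp add: P invertible_det_nz)
    then obtain N' where N': "N (of_real s) ** N' = Finite_Cartesian_Product.mat 1"
      unfolding invertible_def by auto
    define z :: "complex^4" where "z = (\<chi> a. of_real s * y (inv_into UNIV \<iota> a))"
    have "N (of_real s) *v (N' *v z) = z"
      by (simp add: matrix_vector_mul_assoc N')
    then have *: "(\<Sum>b\<in>UNIV. N (of_real s) $ \<iota> j $ b * (N' *v z) $ b) = of_real s * y j" for j
      using inv_f_f[OF \<iota>] by (simp add: matrix_vector_mult_def[of "N (of_real s)"] Finite_Cartesian_Product.vec_eq_iff z_def)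
    have "pairing (N' *v z) (q j + axis (\<iota> j) (of_real (1 / s))) = y j" for j
    proof -
      have "(q j + axis (\<iota> j) (of_real (1 / s))) $ b = N (of_real s) $ \<iota> j $ b / of_real s" for b
        using inv_f_f[OF \<iota>] s by (auto simp: N_def Q_def axis_def field_simps)
      then have "pairing (N' *v z) (q j + axis (\<iota> j) (of_real (1 / s))) =
        (\<Sum>b\<in>UNIV. N (of_real s) $ \<iota> j $ b * (N' *v z) $ b) / of_real s"
        by (simp add: pairing_def sum_divide_distrib mult_ac)
      with * s show ?thesis by simp
    qed
    then show "\<exists>h. \<forall>j. pairing h (q j + axis (\<iota> j) (of_real (1 / s))) = y j" by blast
  qed
  then show ?thesis
    using eventually_gt_at_top[of "max 0 B"] by (rule eventually_mono[rotated])
qed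

section \<open>Classical limits of configurations and the case of at most four world points\<close>

lemma image_formation_limit:
  fixes A :: "nat \<Rightarrow> 'm \<Rightarrow> complex^4^3" and q :: "nat \<Rightarrow> 'n \<Rightarrow> complex^4"
  assumes "\<forall>\<^sub>F k in sequentially. \<forall>i j. same_point (A k i *v q k j) (p i j)"
    and "\<And>i. (\<lambda>k. A k i) \<longlonglongrightarrow> A' i" "\<And>j. (\<lambda>k. q k j) \<longlonglongrightarrow> q' j"
    and "\<And>i. A' i \<noteq> 0" "\<And>j. q' j \<noteq> 0" "\<And>i j. p i j \<noteq> 0"
  shows "(A', q', p) \<in> image_formation"
proof -
  define X :: "(('m, 'n) ifc_var \<Rightarrow> complex) set" where
    "X = {ifc_coords A q p | A q p. (\<forall>i. A i \<noteq> 0) \<and> (\<forall>j. q j \<noteq> 0) \<and> (\<forall>i j. p i j \<noteq> 0) \<and>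
      (\<forall>i j. same_point (A i *v q j) (p i j))}"
  have in_X: "\<forall>\<^sub>F k in sequentially. ifc_coords (A k) (q k) p \<in> X"
    using assms(1)
  proof eventually_elim
    case (elim k)
    then have nz: "A k i *v q k j \<noteq> 0" for i j
      using elim[rule_format, of i j] unfolding same_point_def by blast
    \<comment> \<open>Index types are nonempty, so \<open>undefined\<close> serves as an arbitrary
      index.\<close>
    have "A k i \<noteq> 0" for i
      using nz[of i undefined] by auto
    moreover have "q k j \<noteq> 0" for j
      using nz[of undefined j] by auto
    ultimately show ?case
      unfolding X_def mem_Collect_eq using elim assms(6)
      by (intro exI[of _ "A k"] exI[of _ "q k"] exI[of _ p] conjI refl allI) auto
  qed
  \<comment> \<open>Polynomials are continuous, so the Zariski closure contains the classical limits
    whose coordinate vectors stay nonzero.\<close>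
  have "eval_poly (ifc_coords A' q' p) f = 0" if f: "\<forall>x\<in>X. eval_poly x f = 0" for f
  proof -
    have "(\<lambda>k. eval_poly (ifc_coords (A k) (q k) p) f) \<longlonglongrightarrow> eval_poly (ifc_coords A' q' p) f"
    proof (rule eval_poly_tendsto)
      show "(\<lambda>k. ifc_coords (A k) (q k) p v) \<longlonglongrightarrow> ifc_coords A' q' p v" for v
        by (cases v) (auto intro!: tendsto_vec_nth assms)
    qed
    moreover have "\<forall>\<^sub>F k in sequentially. eval_poly (ifc_coords (A k) (q k) p) f = 0"
      using in_X by eventually_elim (use f in blast)
    ultimately show ?thesis
      by (rule tendsto_unique[OF sequentially_bot _ tendsto_eventually])
  qed
  moreover have "ifc_coords A' q' p \<in> multiproj_coords ifc_blk"
    using assms(4-6) by (simp add: ifc_coords_multiproj)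
  ultimately have "ifc_coords A' q' p \<in> zariski_closure ifc_blk X"
    by (simp add: zariski_closure_def)
  then show ?thesis
    by (simp add: image_formation_def X_def)
qed

lemma scaleR_matrix_vector_mult:
  fixes A :: "complex^'b^'a"
  shows "(c *\<^sub>R A) *v x = of_real c *s (A *v x)"
  by (simp add: Finite_Cartesian_Product.vec_eq_iff matrix_vector_mult_def sum_distrib_left
      scaleR_conv_of_real[where 'a = complex] mult.assoc)

text \<open>Cameras with any prescribed images exist once the world points are linearly independent.
  The given points, which may coincide, are perturbed to independent ones, and a subsequence of the
  normalised cameras converges while the image points stay fixed.\<close>

lemma resectioning_variety_few_points:
  fixes q :: "'n::finite \<Rightarrow> complex^4" and p :: "'m::finite \<Rightarrow> 'n \<Rightarrow> complex^3"
  assumes n: "CARD('n) \<le> 4" and q: "\<And>j. q j \<noteq> 0" and p: "\<And>i j. p i j \<noteq> 0"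
  shows "p \<in> resectioning_variety q"
proof -
  obtain \<iota> :: "'n \<Rightarrow> 4" where \<iota>: "inj \<iota>"
    using card_le_inj[of "UNIV :: 'n set" "UNIV :: 4 set"] n by auto
  define q' where "q' s j = q j + axis (\<iota> j) (of_real (1 / s))" for s :: real and j
  \<comment> \<open>Unit norm makes the set of camera tuples compact and keeps every limit camera
    nonzero.\<close>
  define K where "K = {X :: (complex^4^3)^'m. \<forall>i. norm (X $ i) = 1}"
  have ex: "\<exists>X\<in>K. \<forall>i j. same_point (X $ i *v q' s j) (p i j)"
    if *: "\<forall>y. \<exists>h. \<forall>j. pairing h (q' s j) = y j" for s
  proof -
    have "\<exists>h. \<forall>j. pairing h (q' s j) = p i j $ r" for i r
      using *[rule_format, of "\<lambda>j. p i j $ r"] .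
    then obtain h where h: "\<And>i r j. pairing (h i r) (q' s j) = p i j $ r" by metis
    define A where "A i = (\<chi> r. h i r)" for i
    have A: "A i *v q' s j = p i j" for i j
      by (simp add: Finite_Cartesian_Product.vec_eq_iff matrix_vector_mult_pairing A_def h)
    have A0: "A i \<noteq> 0" for i
      using A[of i undefined] p[of i undefined] by auto
    define X :: "(complex^4^3)^'m" where "X = (\<chi> i. (1 / norm (A i)) *\<^sub>R A i)"
    have "X $ i *v q' s j = of_real (1 / norm (A i)) *s p i j" for i j
      by (simp add: X_def scaleR_matrix_vector_mult A)
    then have "same_point (X $ i *v q' s j) (p i j)" for i j
      using p A0 by (auto simp: same_point_def)
    moreover have "X \<in> K" using A0 by (simp add: K_def X_def)
    ultimately show ?thesis by blast
  qed
  have "\<forall>\<^sub>F k in sequentially. \<exists>X\<in>K. \<forall>i j. same_point (X $ i *v q' (real k) j) (p i j)"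
    using eventually_compose_filterlim[OF eventually_perturbation_independent[OF \<iota>, of q]
        filterlim_real_sequentially] ex
    unfolding q'_def by (rule eventually_mono)
  then obtain k0 where k0: "\<And>k. k \<ge> k0 \<Longrightarrow> \<exists>X\<in>K. \<forall>i j. same_point (X $ i *v q' (real k) j) (p i j)"
    unfolding eventually_sequentially by blast
  then have "\<exists>X\<in>K. \<forall>i j. same_point (X $ i *v q' (real (k0 + k)) j) (p i j)" for k
    by (intro k0) simp
  then obtain X where X: "\<And>k. X k \<in> K" "\<And>k i j. same_point (X k $ i *v q' (real (k0 + k)) j) (p i j)"
    by metis
  have "bounded K"
  proof (rule boundedI)
    fix X assume "X \<in> K"
    then have "norm X \<le> (\<Sum>i\<in>(UNIV :: 'm set). 1)"
      by (subst norm_vec_def, intro order_trans[OF L2_set_le_sum]) (auto simp: K_def)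
    then show "norm X \<le> CARD('m)" by simp
  qed
  moreover have "closed K"
    unfolding K_def by (intro closed_Collect_all closed_Collect_eq continuous_intros)
  ultimately have "compact K" by (simp add: compact_eq_bounded_closed)
  then obtain X' \<rho> where X': "X' \<in> K" "strict_mono \<rho>" "(X \<circ> \<rho>) \<longlonglongrightarrow> X'"
    using X(1) by (meson compact_imp_seq_compact seq_compactE)
  have "((\<lambda>i. X' $ i), q, p) \<in> image_formation"
  proof (rule image_formation_limit)
    show "\<forall>\<^sub>F k in sequentially. \<forall>i j. same_point (X (\<rho> k) $ i *v q' (real (k0 + \<rho> k)) j) (p i j)"
      using X(2) by simp
    show "(\<lambda>k. X (\<rho> k) $ i) \<longlonglongrightarrow> X' $ i" for i
      using X'(3) by (intro tendsto_vec_nth) (simp add: o_def)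
    have "filterlim (\<lambda>k. real (k0 + \<rho> k)) at_top sequentially"
      by (rule filterlim_compose[OF filterlim_real_sequentially filterlim_subseq])
        (use X'(2) in \<open>auto simp: strict_mono_def\<close>)
    then have lim: "((\<lambda>k. 1 / real (k0 + \<rho> k)) \<longlonglongrightarrow> 0)"
      by (intro tendsto_divide_0[OF tendsto_const] filterlim_at_top_imp_at_infinity)
    show "(\<lambda>k. q' (real (k0 + \<rho> k)) j) \<longlonglongrightarrow> q j" for j
    proof (rule vec_tendstoI)
      fix b
      have "(\<lambda>k. if b = \<iota> j then complex_of_real (1 / real (k0 + \<rho> k)) else 0) \<longlonglongrightarrow> 0"
        using tendsto_of_real[OF lim] by (cases "b = \<iota> j") (auto simp del: of_real_divide)
      from tendsto_add[OF tendsto_const this]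
      show "(\<lambda>k. q' (real (k0 + \<rho> k)) j $ b) \<longlonglongrightarrow> q j $ b"
        unfolding q'_def axis_def by simp
    qed
    show "X' $ i \<noteq> 0" for i
      using X'(1) unfolding K_def mem_Collect_eq by (metis norm_zero zero_neq_one)
  qed (use q p in auto)
  then show ?thesis by (auto simp: resectioning_variety_def)
qed

text \<open>Otherwise \<open>potential_dichotomy\<close> gives every camera a potential with at most
  three bad points per coordinate. The world points are fixed, so the resulting curves for the
  separate cameras combine freely into a curve in the variety along which the term \<open>t\<close>
  dominates \<open>f\<close>.\<close>

lemma unbalanced_camera:
  fixes f :: "('m::finite, 'n::finite) img_var cpoly"
  assumes q0: "\<And>j. q j \<noteq> 0"
    and q: "\<And>J. card J = 4 \<Longrightarrow> \<not> coplanar_points (q ` J)"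
    and f: "\<And>p. p \<in> resectioning_variety q \<Longrightarrow> eval_poly (img_coords p) f = 0"
    and t: "t \<in> Poly_Mapping.keys f"
    and w: "\<And>u. u \<in> Poly_Mapping.keys f \<Longrightarrow> u \<noteq> t \<Longrightarrow> weight w u < weight w t"
  shows "\<exists>i \<nu>. \<forall>r. 3 < card {j. \<exists>r'\<in>{r. Poly_Mapping.lookup t (i, j, r) \<noteq> 0}.
    w (i, j, r) + \<nu> r < w (i, j, r') + \<nu> r'}"
proof (rule ccontr)
  assume contra: "\<not> ?thesis"
  define S where "S i j = {r. Poly_Mapping.lookup t (i, j, r) \<noteq> 0}" for i j
  define B where "B i \<nu> r = {j. \<exists>r'\<in>S i j. w (i, j, r) + \<nu> r < w (i, j, r') + \<nu> r'}" for i \<nu> r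
  have "(\<exists>\<nu>. \<forall>r. card (B i \<nu> r) \<le> 3) \<or> (\<exists>\<nu>. \<forall>r. 3 < card (B i \<nu> r))" for i
    unfolding B_def by (rule potential_dichotomy)
  moreover have "\<not> (\<exists>\<nu>. \<forall>r. 3 < card (B i \<nu> r))" for i
    using contra unfolding B_def S_def by simp
  ultimately have "\<exists>\<nu>. \<forall>r. card (B i \<nu> r) \<le> 3" for i by blast
  then obtain \<nu> where \<nu>: "\<And>i r. card (B i (\<nu> i) r) \<le> 3" by metis
  have "\<exists>p c. (\<forall>\<^sub>F s in at_top. (\<lambda>i. p i s) \<in> resectioning_variety q) \<and>
    (\<forall>i j r. ((\<lambda>s. p i s j $ r / of_real (s powr w (i, j, r))) \<longlongrightarrow> c i j r) at_top) \<and>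
    (\<forall>i j. \<forall>r\<in>S i j. c i j r \<noteq> 0)"
  proof (cases "CARD('n) \<ge> 4")
    case True
    \<comment> \<open>Packs the properties for one camera, so that the curves for all cameras are
      chosen at once.\<close>
    define good where "good i A p c \<longleftrightarrow> (\<forall>\<^sub>F s in at_top. \<forall>j. same_point (A s *v q j) (p s j)) \<and>
      (\<forall>j r. ((\<lambda>s. p s j $ r / of_real (s powr w (i, j, r))) \<longlongrightarrow> c j r) at_top) \<and>
      (\<forall>j. \<forall>r\<in>S i j. c j r \<noteq> 0)" for i and A :: "real \<Rightarrow> complex^4^3" and p c
    have "\<exists>A p c. good i A p c" for i
      unfolding good_def
      by (rule camera_family_exists[where w = "\<lambda>j r. w (i, j, r)" and S = "S i" and \<nu> = "\<nu> i", OF q True \<nu>[unfolded B_def]])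
    then obtain A p c where good: "\<And>i. good i (A i) (p i) (c i)" by metis
    have "\<forall>\<^sub>F s in at_top. \<forall>i j. same_point (A i s *v q j) (p i s j)"
      by (rule eventually_all_finite) (use good in \<open>simp add: good_def\<close>)
    then have "\<forall>\<^sub>F s in at_top. (\<lambda>i. p i s) \<in> resectioning_variety q"
      by eventually_elim (rule resectioning_varietyI, blast)
    with good show ?thesis
      unfolding good_def by (intro exI[of _ p] exI[of _ c]) simp
  next
    case False
    \<comment> \<open>With fewer than four points all nonzero image vectors are allowed, so the
      coordinates can be exactly \<open>s powr w\<close>.\<close>
    define p where "p i s = (\<lambda>j. \<chi> r. complex_of_real (s powr w (i, j, r)))" for i :: 'm and s :: real
    have "\<forall>\<^sub>F s in at_top. (\<lambda>i. p i s) \<in> resectioning_variety q"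
      using eventually_gt_at_top[of 0]
    proof eventually_elim
      case (elim s)
      then have "p i s j \<noteq> 0" for i j by (auto simp: p_def Finite_Cartesian_Product.vec_eq_iff)
      with False q0 show ?case by (intro resectioning_variety_few_points) auto
    qed
    moreover have "((\<lambda>s. p i s j $ r / of_real (s powr w (i, j, r))) \<longlongrightarrow> 1) at_top" for i j r
    proof (rule tendsto_eventually)
      show "\<forall>\<^sub>F s in at_top. p i s j $ r / of_real (s powr w (i, j, r)) = 1"
        using eventually_gt_at_top[of 0] by eventually_elim (simp add: p_def)
    qed
    ultimately show ?thesis
      by (intro exI[of _ p] exI[of _ "\<lambda>_ _ _. 1"]) auto
  qed
  then obtain p c where p: "\<forall>\<^sub>F s in at_top. (\<lambda>i. p i s) \<in> resectioning_variety q"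
    "\<And>i j r. ((\<lambda>s. p i s j $ r / of_real (s powr w (i, j, r))) \<longlongrightarrow> c i j r) at_top"
    "\<And>i j r. r \<in> S i j \<Longrightarrow> c i j r \<noteq> 0" by blast
  have "\<forall>\<^sub>F s in at_top. eval_poly (img_coords (\<lambda>i. p i s)) f \<noteq> 0"
  proof (rule eval_poly_eventually_nonzero[where c = "\<lambda>(i, j, r). c i j r", OF _ t w])
    show "((\<lambda>s. img_coords (\<lambda>i. p i s) v / of_real (s powr w v)) \<longlongrightarrow> (case v of (i, j, r) \<Rightarrow> c i j r)) at_top" for v
      using p(2) by (cases v) (auto simp: img_coords_def)
    show "(case v of (i, j, r) \<Rightarrow> c i j r) \<noteq> 0" if "v \<in> Poly_Mapping.keys t" for v
      using that p(3) by (cases v) (auto simp: S_def in_keys_iff)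
  qed auto
  with p(1) have "\<forall>\<^sub>F s in at_top :: real filter. False"
    by eventually_elim (use f in auto)
  then show False by simp
qed

section \<open>Focals\<close>

lemma monom_eval_sum: "monom_eval x (sum f A) = (\<Prod>a\<in>A. monom_eval x (f a))"
  by (induction A rule: infinite_finite_induct) (auto simp: monom_eval_add)

section \<open>Index conversions for rows and columns\<close>

lemma bij_betw_of_nat_3: "bij_betw (of_nat :: nat \<Rightarrow> 3) {..<3} UNIV"
proof -
  have "r \<in> (of_nat :: nat \<Rightarrow> 3) ` {..<3}" for r
    using exhaust_3[of r] by (auto intro: image_eqI[of _ _ 0] image_eqI[of _ _ 1] image_eqI[of _ _ 2])
  then have "(of_nat :: nat \<Rightarrow> 3) ` {..<3} = UNIV" by blast
  then show ?thesis by (simp add: bij_betw_def eq_card_imp_inj_on)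
qed

lemma bij_betw_of_nat_4: "bij_betw (of_nat :: nat \<Rightarrow> 4) {..<4} UNIV"
proof -
  have "c \<in> (of_nat :: nat \<Rightarrow> 4) ` {..<4}" for c
    using exhaust_4[of c]
    by (auto intro: image_eqI[of _ _ 0] image_eqI[of _ _ 1] image_eqI[of _ _ 2] image_eqI[of _ _ 3])
  then have "(of_nat :: nat \<Rightarrow> 4) ` {..<4} = UNIV" by blast
  then show ?thesis by (simp add: bij_betw_def eq_card_imp_inj_on)
qed

lemma sum_UNIV_4: "(\<Sum>c\<in>UNIV. f (c :: 4)) = (\<Sum>d<4. f (of_nat d))"
  by (rule sum.reindex_bij_betw[OF bij_betw_of_nat_4, symmetric])

text \<open>Turns sums over the row positions of a submatrix into sums over the chosen rows.\<close>

lemma bij_betw_pick: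
  assumes "finite R"
  shows "bij_betw (pick R) {..<card R} R"
proof -
  have inj: "inj_on (pick R) {..<card R}"
    by (rule inj_onI) (metis lessThan_iff nat_neq_iff pick_mono_le)
  moreover have "pick R ` {..<card R} \<subseteq> R"
    using pick_in_set_le by auto
  moreover have "card (pick R ` {..<card R}) = card R"
    using inj by (simp add: card_image)
  ultimately show ?thesis
    using assms by (simp add: bij_betw_def card_subset_eq)
qed

lemma sum_lessThan_plus: "(\<Sum>c<(a::nat) + b. f c) = (\<Sum>c<a. f c) + (\<Sum>l<b. f (a + l))"
  for f :: "nat \<Rightarrow> 'a :: comm_monoid_add"
  by (induction b) (auto simp: add.assoc)

lemma lessThan_12: "{..<12 :: nat} = {0, 1, 2, 3, 4, 5, 6, 7, 8, 9, 10, 11}"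
  by (auto simp: less_Suc_eq eval_nat_numeral)

lemma lessThan_4: "{..<4 :: nat} = {0, 1, 2, 3}"
  by auto

section \<open>A single focal: its monomials and its kernel vectors\<close>

context
  fixes q :: "'n \<Rightarrow> complex^4" and i :: 'm and \<sigma> :: "'n list" and R :: "nat set"
  assumes R: "R \<subseteq> {..<3 * length \<sigma>}" "card R = 12 + length \<sigma>"
begin

definition focal :: "('m, 'n) img_var cpoly" where
  "focal = Determinant.det (submatrix (focal_matrix q i \<sigma>) R UNIV)"

text \<open>Indexed by the row number in the full matrix, so that \<open>x div 3\<close> is the
  position of the point and \<open>x mod 3\<close> the coordinate; row \<open>a\<close> of the minor
  has \<open>x = pick R a\<close>.\<close>

definition focal_entry :: "nat \<Rightarrow> nat \<Rightarrow> ('m, 'n) img_var cpoly" where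
  "focal_entry x c = (if c < 12 then Const (if c div 4 = x mod 3 then q (\<sigma> ! (x div 3)) $ of_nat (c mod 4) else 0)
    else if c = 12 + x div 3 then Var (i, \<sigma> ! (x div 3), of_nat (x mod 3)) else 0)"

lemma finite_R: "finite R"
  using R(1) finite_subset by blast

lemma submatrix_focal_matrix:
  "submatrix (focal_matrix q i \<sigma>) R UNIV =
    Matrix.mat (12 + length \<sigma>) (12 + length \<sigma>) (\<lambda>(a, c). focal_entry (pick R a) c)" (is "_ = ?M")
proof (rule eq_matI)
  have "{x. x < 3 * length \<sigma> \<and> x \<in> R} = R" using R(1) by auto
  then have dim: "dim_row (submatrix (focal_matrix q i \<sigma>) R UNIV) = 12 + length \<sigma>"
    "dim_col (submatrix (focal_matrix q i \<sigma>) R UNIV) = 12 + length \<sigma>"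
    using R(2) by (simp_all add: dim_submatrix focal_matrix_def)
  then show "dim_row (submatrix (focal_matrix q i \<sigma>) R UNIV) = dim_row ?M"
    "dim_col (submatrix (focal_matrix q i \<sigma>) R UNIV) = dim_col ?M" by simp_all
  fix a c assume "a < dim_row ?M" "c < dim_col ?M"
  then have ac: "a < 12 + length \<sigma>" "c < 12 + length \<sigma>" by simp_all
  have "pick R a \<in> R" using ac R(2) by (intro pick_in_set_le) simp
  then have x: "pick R a < 3 * length \<sigma>" using R(1) by auto
  have "submatrix (focal_matrix q i \<sigma>) R UNIV $$ (a, c) = focal_matrix q i \<sigma> $$ (pick R a, pick UNIV c)"
    by (rule submatrix_index) (use ac dim in \<open>auto simp: dim_submatrix\<close>)
  also have "\<dots> = focal_entry (pick R a) c"
    using x ac by (auto simp: focal_matrix_def focal_entry_def pick_UNIV Qbar_def)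
  finally show "submatrix (focal_matrix q i \<sigma>) R UNIV $$ (a, c) = ?M $$ (a, c)"
    using ac by simp
qed

text \<open>A permutation contributing to the determinant matches the column of each point with one
  of its own rows, and the four columns of each block of the first twelve with rows of that residue.
  So the coordinates \<open>s l\<close> are the residues of the rows in \<open>R\<close> with each
  residue removed four times. The last conclusion says this through test functions
  \<open>\<nu>\<close>: a potential contributes equally to all monomials of the focal.\<close>

lemma focal_keys:
  assumes "t \<in> Poly_Mapping.keys focal"
  obtains s where "\<And>l. l < length \<sigma> \<Longrightarrow> s l < 3" "\<And>l. l < length \<sigma> \<Longrightarrow> 3 * l + s l \<in> R"
    "t = (\<Sum>l<length \<sigma>. Poly_Mapping.single (i, \<sigma> ! l, of_nat (s l)) 1)"
    "\<And>\<nu> :: nat \<Rightarrow> real. (\<Sum>l<length \<sigma>. \<nu> (s l)) = (\<Sum>x\<in>R. \<nu> (x mod 3)) - 4 * (\<nu> 0 + \<nu> 1 + \<nu> 2)"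
proof -
  define N where "N = 12 + length \<sigma>"
  let ?x = "pick R"
  have "focal = (\<Sum>p | p permutes {0..<N}. signof p * (\<Prod>a = 0..<N. focal_entry (?x a) (p a)))"
    unfolding focal_def submatrix_focal_matrix N_def[symmetric]
    by (subst det_def'[of _ N])
      (auto intro!: sum.cong prod.cong arg_cong2[where f = times] dest: permutes_in_image)
  then have "Poly_Mapping.keys focal \<subseteq> (\<Union>p\<in>{p. p permutes {0..<N}}.
      Poly_Mapping.keys (signof p * (\<Prod>a = 0..<N. focal_entry (?x a) (p a))))"
    by (simp only: keys_sum)
  with assms obtain p where p: "p permutes {0..<N}"
    "t \<in> Poly_Mapping.keys (signof p * (\<Prod>a = 0..<N. focal_entry (?x a) (p a)))"
    by blast
  from p(2) have "t \<in> Poly_Mapping.keys (\<Prod>a = 0..<N. focal_entry (?x a) (p a))"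
    by (auto simp: sign_def split: if_splits)
  then obtain \<kappa> where \<kappa>: "\<And>a. a \<in> {0..<N} \<Longrightarrow> \<kappa> a \<in> Poly_Mapping.keys (focal_entry (?x a) (p a))"
    "t = sum \<kappa> {0..<N}" by (rule keys_prodE) auto
  \<comment> \<open>The inverse permutation sends a column to the row that it is matched
    with.\<close>
  define p' where "p' = inv_into UNIV p"
  have p': "p' permutes {0..<N}" unfolding p'_def by (rule permutes_inv[OF p(1)])
  have pp': "p (p' c) = c" for c
    unfolding p'_def using permutes_inverses(1)[OF p(1)] by simp
  have p'_less: "p' c < N" if "c < N" for c
    using permutes_in_image[OF p', of c] that by simp
  \<comment> \<open>A nonzero constant entry in column \<open>c < 12\<close> lies in a row of
    residue \<open>c div 4\<close> and adds nothing to the exponent.\<close>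
  have low: "\<kappa> (p' c) = 0" "c div 4 = ?x (p' c) mod 3" if "c < 12" for c
    using \<kappa>(1)[of "p' c"] p'_less[of c] that
    by (auto simp: focal_entry_def pp' Const_def N_def split: if_splits)
  have high: "?x (p' (12 + l)) div 3 = l"
    "\<kappa> (p' (12 + l)) = Poly_Mapping.single (i, \<sigma> ! l, of_nat (?x (p' (12 + l)) mod 3)) 1"
    if "l < length \<sigma>" for l
    using \<kappa>(1)[of "p' (12 + l)"] p'_less[of "12 + l"] that
    by (auto simp: focal_entry_def pp' Var_def N_def split: if_splits)
  have reindex: "(\<Sum>a<N. f a) = (\<Sum>c<12. f (p' c)) + (\<Sum>l<length \<sigma>. f (p' (12 + l)))"
    for f :: "nat \<Rightarrow> 'z :: comm_monoid_add"
  proof -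
    have "(\<Sum>a<N. f a) = (\<Sum>c<N. f (p' c))"
      using sum.reindex_bij_betw[OF permutes_imp_bij[OF p'], of f] by (simp add: lessThan_atLeast0)
    then show ?thesis by (simp add: N_def sum_lessThan_plus)
  qed
  define s where "s l = ?x (p' (12 + l)) mod 3" for l
  show ?thesis
  proof (rule that[of s])
    show "s l < 3" if "l < length \<sigma>" for l by (simp add: s_def)
    show "3 * l + s l \<in> R" if "l < length \<sigma>" for l
    proof -
      have "?x (p' (12 + l)) \<in> R"
        using p'_less[of "12 + l"] that R(2) by (intro pick_in_set_le) (simp add: N_def)
      moreover have "3 * l + s l = ?x (p' (12 + l))"
        using high(1)[OF that] unfolding s_def by presburger
      ultimately show ?thesis by simp
    qed
    have "t = (\<Sum>a<N. \<kappa> a)" by (simp add: \<kappa>(2) lessThan_atLeast0)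
    then show "t = (\<Sum>l<length \<sigma>. Poly_Mapping.single (i, \<sigma> ! l, of_nat (s l)) 1)"
      by (simp add: reindex low(1) high(2) s_def)
    fix \<nu> :: "nat \<Rightarrow> real"
    have "(\<Sum>x\<in>R. \<nu> (x mod 3)) = (\<Sum>a<N. \<nu> (?x a mod 3))"
      using sum.reindex_bij_betw[OF bij_betw_pick[OF finite_R], of "\<lambda>x. \<nu> (x mod 3)"] R(2)
      by (simp add: N_def)
    also have "\<dots> = (\<Sum>c<12. \<nu> (c div 4)) + (\<Sum>l<length \<sigma>. \<nu> (s l))"
      unfolding reindex s_def by (intro arg_cong2[where f = "(+)"] sum.cong refl) (simp add: low(2))
    also have "(\<Sum>c<12. \<nu> (c div 4)) = 4 * (\<nu> 0 + \<nu> 1 + \<nu> 2)"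
      by (simp add: lessThan_12)
    finally show "(\<Sum>l<length \<sigma>. \<nu> (s l)) = (\<Sum>x\<in>R. \<nu> (x mod 3)) - 4 * (\<nu> 0 + \<nu> 1 + \<nu> 2)"
      by simp
  qed
qed

lemma multihomogeneous_focal: "multihomogeneous img_blk focal"
proof (rule multihomogeneousI)
  fix t assume "t \<in> Poly_Mapping.keys focal"
  then obtain s where "t = (\<Sum>l<length \<sigma>. Poly_Mapping.single (i, \<sigma> ! l, of_nat (s l)) 1)"
    by (rule focal_keys)
  then show "blk_degree img_blk t = (\<lambda>b. \<Sum>l<length \<sigma>. if (i, \<sigma> ! l) = b then 1 else 0)"
    by (auto simp: fun_eq_iff blk_degree_sum img_blk_def)
qed

text \<open>Over a field the determinant vanishes iff the evaluated matrix has a nonzero kernel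
  vector \<open>u\<close>. Its first twelve entries are the rows of a candidate camera, the others
  the negatives of scale factors for the image points.\<close>

lemma eval_focal_eq_0_iff:
  "eval_poly y focal = 0 \<longleftrightarrow> (\<exists>u. (\<exists>c<12 + length \<sigma>. u c \<noteq> 0) \<and> (\<forall>x\<in>R.
    (\<Sum>d<4. q (\<sigma> ! (x div 3)) $ of_nat d * u (4 * (x mod 3) + d)) +
    y (i, \<sigma> ! (x div 3), of_nat (x mod 3)) * u (12 + x div 3) = 0))" (is "_ \<longleftrightarrow> (\<exists>u. ?nz u \<and> (\<forall>x\<in>R. ?row u x = 0))")
proof -
  define N where "N = 12 + length \<sigma>"
  define M where "M = Matrix.mat N N (\<lambda>(a, c). eval_poly y (focal_entry (pick R a) c))"
  have "eval_poly y focal = Determinant.det (map_mat (eval_poly y) (submatrix (focal_matrix q i \<sigma>) R UNIV))"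
    by (simp add: focal_def eval_poly.hom_det)
  also have "map_mat (eval_poly y) (submatrix (focal_matrix q i \<sigma>) R UNIV) = M"
    unfolding submatrix_focal_matrix M_def N_def by (rule eq_matI) auto
  finally have det: "eval_poly y focal = Determinant.det M" .
  have M: "M \<in> carrier_mat N N" by (simp add: M_def)
  have x: "pick R a \<in> R" "pick R a div 3 < length \<sigma>" if "a < N" for a
  proof -
    show "pick R a \<in> R" using that R(2) by (intro pick_in_set_le) (simp add: N_def)
    then show "pick R a div 3 < length \<sigma>" using R(1) by auto
  qed
  have row: "(\<Sum>c<N. eval_poly y (focal_entry x c) * u c) = ?row u x" if "x div 3 < length \<sigma>" for u x
  proof -
    have "(\<Sum>c<12. eval_poly y (focal_entry x c) * u c) =
        (\<Sum>c<12. if c div 4 = x mod 3 then q (\<sigma> ! (x div 3)) $ of_nat (c mod 4) * u c else 0)"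
      by (rule sum.cong) (auto simp: focal_entry_def)
    also have "\<dots> = (\<Sum>d<4. q (\<sigma> ! (x div 3)) $ of_nat d * u (4 * (x mod 3) + d))"
    proof -
      have "x mod 3 = 0 \<or> x mod 3 = 1 \<or> x mod 3 = 2" by presburger
      then show ?thesis by (elim disjE) (simp_all add: lessThan_12 lessThan_4)
    qed
    finally have 1: "(\<Sum>c<12. eval_poly y (focal_entry x c) * u c) = \<dots>" .
    have "(\<Sum>l<length \<sigma>. eval_poly y (focal_entry x (12 + l)) * u (12 + l)) =
        (\<Sum>l<length \<sigma>. if l = x div 3 then y (i, \<sigma> ! (x div 3), of_nat (x mod 3)) * u (12 + x div 3) else 0)"
      by (rule sum.cong) (auto simp: focal_entry_def)
    also have "\<dots> = y (i, \<sigma> ! (x div 3), of_nat (x mod 3)) * u (12 + x div 3)"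
      using that by simp
    finally show ?thesis using 1 by (simp add: N_def sum_lessThan_plus)
  qed
  have mult: "vec_index (M *\<^sub>v v) a = ?row (vec_index v) (pick R a)" if "a < N" "v \<in> carrier_vec N" for a v
  proof -
    have "vec_index (M *\<^sub>v v) a = (\<Sum>c<N. eval_poly y (focal_entry (pick R a) c) * vec_index v c)"
      using that by (simp add: M_def scalar_prod_def lessThan_atLeast0)
    with row[OF x(2)[OF that(1)]] show ?thesis by simp
  qed
  have "eval_poly y focal = 0 \<longleftrightarrow> (\<exists>v. v \<in> carrier_vec N \<and> v \<noteq> 0\<^sub>v N \<and> M *\<^sub>v v = 0\<^sub>v N)"
    unfolding det by (rule det_0_iff_vec_prod_zero_field[OF M])
  also have "\<dots> \<longleftrightarrow> (\<exists>u. ?nz u \<and> (\<forall>x\<in>R. ?row u x = 0))"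
  proof
    assume "\<exists>v. v \<in> carrier_vec N \<and> v \<noteq> 0\<^sub>v N \<and> M *\<^sub>v v = 0\<^sub>v N"
    then obtain v where v: "v \<in> carrier_vec N" "v \<noteq> 0\<^sub>v N" "M *\<^sub>v v = 0\<^sub>v N" by blast
    have "?row (vec_index v) x = 0" if "x \<in> R" for x
    proof -
      have "x \<in> pick R ` {..<N}"
        using bij_betw_pick[OF finite_R] that R(2) by (simp add: bij_betw_def N_def)
      then obtain a where "a < N" "x = pick R a" by auto
      with mult[of a v] v show ?thesis by simp
    qed
    moreover have "\<exists>c<N. vec_index v c \<noteq> 0"
      using v(1,2) by (metis carrier_vecD eq_vecI index_zero_vec)
    ultimately show "\<exists>u. ?nz u \<and> (\<forall>x\<in>R. ?row u x = 0)"
      unfolding N_def by blast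
  next
    assume "\<exists>u. ?nz u \<and> (\<forall>x\<in>R. ?row u x = 0)"
    then obtain u c where u: "c < N" "u c \<noteq> 0" "\<And>x. x \<in> R \<Longrightarrow> ?row u x = 0"
      unfolding N_def by blast
    let ?v = "Matrix.vec N u"
    have "M *\<^sub>v ?v = 0\<^sub>v N"
    proof (rule eq_vecI)
      fix a assume "a < dim_vec (0\<^sub>v N)"
      then have a: "a < N" by simp
      have "?row (vec_index ?v) (pick R a) = ?row u (pick R a)"
        using x(2)[OF a] by (intro arg_cong2[where f = "(+)"] sum.cong) (auto simp: N_def)
      with mult[OF a, of ?v] u(3)[OF x(1)[OF a]] a show "vec_index (M *\<^sub>v ?v) a = vec_index (0\<^sub>v N) a"
        by simp
    qed (simp add: M_def)
    moreover have "?v \<noteq> 0\<^sub>v N"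
    proof
      assume "?v = 0\<^sub>v N"
      then have "vec_index ?v c = vec_index (0\<^sub>v N) c" by simp
      with u show False by simp
    qed
    ultimately show "\<exists>v. v \<in> carrier_vec N \<and> v \<noteq> 0\<^sub>v N \<and> M *\<^sub>v v = 0\<^sub>v N"
      by (intro exI[of _ ?v]) auto
  qed
  finally show ?thesis .
qed

end

lemma ex_of_nat_3: "\<exists>a<3. (r :: 3) = of_nat a"
  using bij_betw_of_nat_3 by (auto simp: bij_betw_def)

lemma ex_of_nat_4: "\<exists>a<4. (c :: 4) = of_nat a"
  using bij_betw_of_nat_4 by (auto simp: bij_betw_def)

lemma focalsE:
  assumes "g \<in> focals q k"
  obtains i \<sigma> R where "distinct \<sigma>" "length \<sigma> = k" "R \<subseteq> {..<3 * length \<sigma>}" "card R = 12 + length \<sigma>"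
    "g = focal q i \<sigma> R"
  using assms unfolding focals_def focal_def by blast

text \<open>By the relations \<open>A i *v q j = c i j *s p i j\<close>, the entries of the camera
  followed by the negated factors form a kernel vector. It is nonzero because the camera is, even if
  all factors vanish.\<close>

lemma focal_vanishes:
  assumes g: "g \<in> focals q k" and p: "p \<in> resectioning_variety q"
  shows "eval_poly (img_coords p) g = 0"
proof -
  obtain i \<sigma> R where "distinct \<sigma>" "length \<sigma> = k"
    and R: "R \<subseteq> {..<3 * length \<sigma>}" "card R = 12 + length \<sigma>" and g: "g = focal q i \<sigma> R"
    using g by (rule focalsE)
  obtain A c where A: "\<And>i. A i \<noteq> 0" "\<And>i j. p i j \<noteq> 0" "\<And>i j. A i *v q j = c i j *s p i j"
    by (rule resectioning_varietyD[OF p]) blast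
  define u where "u x = (if x < 12 then A i $ of_nat (x div 4) $ of_nat (x mod 4) else - c i (\<sigma> ! (x - 12)))" for x
  have "\<exists>r c. A i $ r $ c \<noteq> 0"
    using A(1)[of i] by (auto simp: Finite_Cartesian_Product.vec_eq_iff)
  then obtain a b where ab: "A i $ a $ b \<noteq> 0" by blast
  obtain a' b' where ab': "a' < 3" "a = of_nat a'" "b' < 4" "b = of_nat b'"
    using ex_of_nat_3[of a] ex_of_nat_4[of b] by blast
  have "u (4 * a' + b') \<noteq> 0"
    using ab ab' by (simp add: u_def)
  moreover have "4 * a' + b' < 12 + length \<sigma>" using ab' by simp
  moreover have "(\<Sum>d<4. q (\<sigma> ! (x div 3)) $ of_nat d * u (4 * (x mod 3) + d)) +
    img_coords p (i, \<sigma> ! (x div 3), of_nat (x mod 3)) * u (12 + x div 3) = 0" for x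
  proof -
    let ?j = "\<sigma> ! (x div 3)" and ?r = "of_nat (x mod 3) :: 3"
    have "(\<Sum>d<4. q ?j $ of_nat d * u (4 * (x mod 3) + d)) = (\<Sum>d<4. A i $ ?r $ of_nat d * q ?j $ of_nat d)"
    proof (rule sum.cong)
      fix d :: nat assume "d \<in> {..<4}"
      moreover from this have "4 * (x mod 3) + d < 12"
        using mod_less_divisor[of 3 x] by (simp del: mod_less_divisor)
      ultimately show "q ?j $ of_nat d * u (4 * (x mod 3) + d) = A i $ ?r $ of_nat d * q ?j $ of_nat d"
        by (simp add: u_def)
    qed simp
    also have "\<dots> = (A i *v q ?j) $ ?r"
      by (simp add: matrix_vector_mult_pairing pairing_def sum_UNIV_4)
    finally show ?thesis
      by (simp add: A(3) u_def img_coords_def)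
  qed
  ultimately show ?thesis
    unfolding g eval_focal_eq_0_iff[OF R] by (intro exI[of _ u] conjI exI[of _ "4 * a' + b'"] ballI)
qed

lemma finite_focals: "finite (focals (q :: 'n::finite \<Rightarrow> _) k :: ('m::finite, 'n) img_var cpoly set)"
proof (rule finite_subset)
  let ?f = "\<lambda>(i, \<sigma>, R). Determinant.det (submatrix (focal_matrix q i \<sigma>) R UNIV) :: ('m, 'n) img_var cpoly"
  show "focals q k \<subseteq> ?f ` (UNIV \<times> {\<sigma>. set \<sigma> \<subseteq> UNIV \<and> length \<sigma> = k} \<times> Pow {..<3 * k})"
    unfolding focals_def by force
  show "finite (?f ` (UNIV \<times> {\<sigma>. set \<sigma> \<subseteq> UNIV \<and> length \<sigma> = k} \<times> Pow {..<3 * k}))"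
    by (intro finite_imageI finite_cartesian_product finite_lists_length_eq finite_Pow_iff[THEN iffD2]) auto
qed

text \<open>The rows of the focal are the variables \<open>(j, s j)\<close> of its leading monomial together with the
  \<open>4 + 4 + 4\<close> rows given by \<open>B\<close>, and \<open>\<nu>\<close> is an optimal dual solution of the assignment problem
  that the leading monomial solves.\<close>

lemma focal_with_lead_monomial:
  fixes q :: "'n::finite \<Rightarrow> complex^4" and i :: "'m::finite" and w :: "('m, 'n) img_var \<Rightarrow> real"
  assumes q: "\<And>J. card J = 4 \<Longrightarrow> \<not> coplanar_points (q ` J)"
    and B: "\<And>r. card (B r) = 4"
    and s: "\<And>r j. j \<in> B r \<Longrightarrow> w (i, j, r) + \<nu> r < w (i, j, s j) + \<nu> (s j)"
  shows "\<exists>k g t. 6 \<le> k \<and> k \<le> 12 \<and> g \<in> focals q k \<and> t \<in> Poly_Mapping.keys g \<and>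
    (\<forall>u\<in>Poly_Mapping.keys g. weight w u \<le> weight w t) \<and>
    (\<forall>v. Poly_Mapping.lookup t v \<le> 1 \<and> (Poly_Mapping.lookup t v \<noteq> 0 \<longrightarrow> (\<exists>j. v = (i, j, s j) \<and> (\<exists>r. j \<in> B r))))"
proof -
  define J where "J = (\<Union>r. B r)"
  define k where "k = card J"
  define Z where "Z = (SIGMA j:J. {r. j \<in> B r})"
  have card_Z: "card Z = 12"
  proof -
    have "bij_betw prod.swap (SIGMA r:UNIV. B r) Z"
      by (rule bij_betwI[where g = prod.swap]) (auto simp: Z_def J_def)
    then have "card Z = card (SIGMA r:UNIV. B r)" by (simp add: bij_betw_same_card)
    also have "\<dots> = 12" by (simp add: B)
    finally show ?thesis .
  qed
  \<comment> \<open>The strict inequality excludes \<open>r = s j\<close>. Hence the twelve rows are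
    spread over at least six points.\<close>
  have "card {r. j \<in> B r} \<le> 2" for j
  proof -
    have "{r. j \<in> B r} \<subseteq> UNIV - {s j}" using s by fastforce
    then have "card {r. j \<in> B r} \<le> card (UNIV - {s j})" by (intro card_mono) auto
    then show ?thesis by simp
  qed
  then have "(\<Sum>j\<in>J. card {r. j \<in> B r}) \<le> (\<Sum>j\<in>J. 2)"
    by (intro sum_mono)
  moreover have "card Z = (\<Sum>j\<in>J. card {r. j \<in> B r})"
    unfolding Z_def by (rule card_SigmaI) auto
  ultimately have "6 \<le> k" using card_Z by (simp add: k_def)
  have "card J \<le> (\<Sum>r\<in>UNIV. card (B r))"
    unfolding J_def by (rule card_UN_le) simp
  then have "k \<le> 12" by (simp add: B k_def)
  obtain \<sigma> where \<sigma>: "set \<sigma> = J" "distinct \<sigma>"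
    using finite_distinct_list[of J] by auto
  then have len: "length \<sigma> = k" by (simp add: k_def distinct_card flip: \<sigma>(1))
  define \<phi> :: "nat \<Rightarrow> 'n \<times> 3" where "\<phi> x = (\<sigma> ! (x div 3), of_nat (x mod 3))" for x
  have \<phi>: "bij_betw \<phi> {..<3 * k} (J \<times> UNIV)"
  proof -
    have bij: "bij_betw (\<lambda>l. \<sigma> ! l) {..<k} J"
      using bij_betw_nth[OF \<sigma>(2)] \<sigma>(1) len by auto
    have "bij_betw (\<lambda>x. (x div 3, x mod 3)) {..<3 * k} ({..<k} \<times> {..<3})"
      by (rule bij_betwI[where g = "\<lambda>(l, r). 3 * l + r"]) auto
    from bij_betw_trans[OF this bij_betw_map_prod[OF bij bij_betw_of_nat_3]]
    show ?thesis by (simp add: \<phi>_def[abs_def] o_def)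
  qed
  define Z' where "Z' = Z \<union> (\<lambda>j. (j, s j)) ` J"
  define R where "R = {x \<in> {..<3 * k}. \<phi> x \<in> Z'}"
  have "card Z' = 12 + k"
  proof -
    have "card Z' = card Z + card ((\<lambda>j. (j, s j)) ` J)"
      unfolding Z'_def by (rule card_Un_disjoint) (use s in \<open>fastforce simp: Z_def\<close>)+
    then show ?thesis by (simp add: card_Z k_def card_image inj_on_def)
  qed
  moreover have "bij_betw \<phi> R Z'"
  proof (rule bij_betw_subset[OF \<phi>])
    have "Z' \<subseteq> J \<times> UNIV" by (auto simp: Z'_def Z_def)
    moreover have "\<phi> ` {..<3 * k} = J \<times> UNIV" using \<phi> by (simp add: bij_betw_def)
    moreover have "\<phi> ` R = \<phi> ` {..<3 * k} \<inter> Z'" by (auto simp: R_def)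
    ultimately show "\<phi> ` R = Z'" by (simp add: Int_absorb1)
  qed (auto simp: R_def)
  ultimately have R: "R \<subseteq> {..<3 * length \<sigma>}" "card R = 12 + length \<sigma>"
    using bij_betw_same_card[of \<phi> R Z'] by (auto simp: R_def len)
  define g :: "('m, 'n) img_var cpoly" where "g = focal q i \<sigma> R"
  have g: "g \<in> focals q k"
    unfolding g_def focal_def[OF R] focals_def mem_Collect_eq using R \<sigma>(2) len
    by (intro exI[of _ i] exI[of _ \<sigma>] exI[of _ R]) simp
  have in_R: "3 * l + a \<in> R \<longleftrightarrow> (of_nat a = s (\<sigma> ! l) \<or> \<sigma> ! l \<in> B (of_nat a))" if "l < k" "a < 3" for l a
  proof -
    have "\<sigma> ! l \<in> J" using that len \<sigma>(1) by auto
    then show ?thesis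
      using that by (auto simp: R_def \<phi>_def Z'_def Z_def)
  qed
  \<comment> \<open>Setting the variables \<open>(i, j, s j)\<close> to 1 and the other coordinates
    to 0 isolates the desired monomial; nonvanishing at \<open>y\<close> shows that it really
    occurs.\<close>
  define y :: "('m, 'n) img_var \<Rightarrow> complex" where "y = (\<lambda>(i, j, r). if r = s j then 1 else 0)"
  have "eval_poly y g \<noteq> 0"
    unfolding g_def eval_focal_eq_0_iff[OF R]
  proof
    assume "\<exists>u. (\<exists>c<12 + length \<sigma>. u c \<noteq> 0) \<and> (\<forall>x\<in>R.
      (\<Sum>d<4. q (\<sigma> ! (x div 3)) $ of_nat d * u (4 * (x mod 3) + d)) +
      y (i, \<sigma> ! (x div 3), of_nat (x mod 3)) * u (12 + x div 3) = 0)"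
    then obtain u c where u: "c < 12 + k" "u c \<noteq> 0" "\<And>x. x \<in> R \<Longrightarrow>
      (\<Sum>d<4. q (\<sigma> ! (x div 3)) $ of_nat d * u (4 * (x mod 3) + d)) +
      y (i, \<sigma> ! (x div 3), of_nat (x mod 3)) * u (12 + x div 3) = 0"
      unfolding len by blast
    have row: "(\<Sum>d<4. q (\<sigma> ! l) $ of_nat d * u (4 * a + d)) + y (i, \<sigma> ! l, of_nat a) * u (12 + l) = 0"
      if "l < k" "a < 3" "of_nat a = s (\<sigma> ! l) \<or> \<sigma> ! l \<in> B (of_nat a)" for l a
      using u(3)[of "3 * l + a"] in_R[OF that(1,2)] that by simp
    \<comment> \<open>In the rows given by \<open>B\<close> the image entry is 0 at
      \<open>y\<close>, so row \<open>a\<close> of the candidate camera annihilates four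
      non-coplanar points.\<close>
    have low: "u (4 * a + d) = 0" if "a < 3" "d < 4" for a d
    proof -
      define h :: "complex^4" where "h = (\<chi> c. u (4 * a + inv_into {..<4} of_nat c))"
      have h: "h $ of_nat d = u (4 * a + d)" if "d < 4" for d
        using bij_betw_of_nat_4 that by (simp add: h_def bij_betw_def inv_into_f_f)
      have "pairing h (q j) = 0" if "j \<in> B (of_nat a)" for j
      proof -
        from that have "j \<in> set \<sigma>" by (auto simp: \<sigma>(1) J_def)
        then obtain l where l: "l < k" "j = \<sigma> ! l" by (auto simp: in_set_conv_nth len)
        have "of_nat a \<noteq> s j" using s[OF that] by auto
        with row[of l a] l that \<open>a < 3\<close> have "(\<Sum>d<4. q j $ of_nat d * u (4 * a + d)) = 0"
          by (simp add: y_def)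
        then show ?thesis by (simp add: pairing_def sum_UNIV_4 h mult.commute)
      qed
      with q[OF B, of "of_nat a"] have "h = 0"
        unfolding coplanar_points_pairing by blast
      then show ?thesis using h[OF \<open>d < 4\<close>] by simp
    qed
    \<comment> \<open>The row \<open>(j, s j)\<close> has image entry 1 and a vanishing camera part,
      so the scale factor vanishes too.\<close>
    have "u (12 + l) = 0" if "l < k" for l
    proof -
      obtain a where a: "a < 3" "s (\<sigma> ! l) = of_nat a"
        using ex_of_nat_3[of "s (\<sigma> ! l)"] by blast
      with row[of l a] that show ?thesis by (simp add: low y_def)
    qed
    then have high: "u c = 0" if "12 \<le> c" "c < 12 + k" for c
      using that by (metis add_less_cancel_left le_Suc_ex)
    have "u c = 0" if "c < 12" for c
      using low[of "c div 4" "c mod 4"] that by simp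
    with high u(1,2) show False by (metis not_le)
  qed
  moreover have "eval_poly y g = (\<Sum>t\<in>Poly_Mapping.keys g. Poly_Mapping.lookup g t * monom_eval y t)"
    by (rule eval_poly_superset) auto
  ultimately obtain t where t: "t \<in> Poly_Mapping.keys g" "monom_eval y t \<noteq> 0"
    by (metis (no_types, lifting) mult_zero_right sum.neutral)
  have keysE: "\<exists>a. (\<forall>l<k. a l < 3 \<and> 3 * l + a l \<in> R) \<and>
      u = (\<Sum>l<k. Poly_Mapping.single (i, \<sigma> ! l, of_nat (a l)) 1) \<and>
      (\<Sum>l<k. \<nu> (of_nat (a l))) = (\<Sum>x\<in>R. \<nu> (of_nat (x mod 3))) - 4 * (\<nu> 0 + \<nu> 1 + \<nu> 2)"
    if u: "u \<in> Poly_Mapping.keys g" for u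
  proof -
    show ?thesis
    proof (rule focal_keys[OF R u[unfolded g_def]], unfold len)
      fix a assume "\<And>l. l < k \<Longrightarrow> a l < 3" "\<And>l. l < k \<Longrightarrow> 3 * l + a l \<in> R"
        "u = (\<Sum>l<k. Poly_Mapping.single (i, \<sigma> ! l, of_nat (a l)) 1)"
        "\<And>\<nu> :: nat \<Rightarrow> real. (\<Sum>l<k. \<nu> (a l)) = (\<Sum>x\<in>R. \<nu> (x mod 3)) - 4 * (\<nu> 0 + \<nu> 1 + \<nu> 2)"
      from this(1-3) this(4)[of "\<lambda>a. \<nu> (of_nat a)"] show ?thesis
        by (intro exI[of _ a]) simp
    qed
  qed
  obtain a where a: "\<And>l. l < k \<Longrightarrow> a l < 3"
    "t = (\<Sum>l<k. Poly_Mapping.single (i, \<sigma> ! l, of_nat (a l)) 1)"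
    "(\<Sum>l<k. \<nu> (of_nat (a l))) = (\<Sum>x\<in>R. \<nu> (of_nat (x mod 3))) - 4 * (\<nu> 0 + \<nu> 1 + \<nu> 2)"
    using keysE[OF t(1)] by blast
  \<comment> \<open>Only variables \<open>(i, j, s j)\<close> are nonzero at \<open>y\<close>, so a
    monomial surviving there uses no others.\<close>
  have as: "of_nat (a l) = s (\<sigma> ! l)" if "l < k" for l
    using t(2) that unfolding a(2) by (auto simp: monom_eval_sum y_def split: if_splits)
  have "weight w u \<le> weight w t" if "u \<in> Poly_Mapping.keys g" for u
  proof -
    obtain b where b: "\<And>l. l < k \<Longrightarrow> b l < 3 \<and> 3 * l + b l \<in> R"
      "u = (\<Sum>l<k. Poly_Mapping.single (i, \<sigma> ! l, of_nat (b l)) 1)"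
      "(\<Sum>l<k. \<nu> (of_nat (b l))) = (\<Sum>x\<in>R. \<nu> (of_nat (x mod 3))) - 4 * (\<nu> 0 + \<nu> 1 + \<nu> 2)"
      using keysE[OF \<open>u \<in> _\<close>] by blast
    \<comment> \<open>Termwise comparison after adding the potential; its total contribution is the
      same for \<open>u\<close> and \<open>t\<close>, so it cancels afterwards.\<close>
    have "(\<Sum>l<k. w (i, \<sigma> ! l, of_nat (b l)) + \<nu> (of_nat (b l))) \<le>
      (\<Sum>l<k. w (i, \<sigma> ! l, of_nat (a l)) + \<nu> (of_nat (a l)))"
    proof (rule sum_mono)
      fix l assume "l \<in> {..<k}"
      then have l: "l < k" by simp
      with b(1)[OF l] in_R[of l "b l"] have "of_nat (b l) = s (\<sigma> ! l) \<or> \<sigma> ! l \<in> B (of_nat (b l))" by simp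
      then show "w (i, \<sigma> ! l, of_nat (b l)) + \<nu> (of_nat (b l)) \<le> w (i, \<sigma> ! l, of_nat (a l)) + \<nu> (of_nat (a l))"
        using s[of "\<sigma> ! l" "of_nat (b l)"] as[OF l] by auto
    qed
    then show ?thesis
      using a(3) b(3) unfolding a(2) b(2) by (simp add: weight_sum sum.distrib)
  qed
  moreover have "Poly_Mapping.lookup t v \<le> 1 \<and>
    (Poly_Mapping.lookup t v \<noteq> 0 \<longrightarrow> (\<exists>j. v = (i, j, s j) \<and> (\<exists>r. j \<in> B r)))" for v
  proof -
    have "t = (\<Sum>j\<in>J. Poly_Mapping.single (i, j, s j) 1)"
    proof -
      have "bij_betw (\<lambda>l. \<sigma> ! l) {..<k} J"
        using bij_betw_nth[OF \<sigma>(2)] \<sigma>(1) len by auto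
      from sum.reindex_bij_betw[OF this, of "\<lambda>j. Poly_Mapping.single (i, j, s j) (1 :: nat)"]
      show ?thesis using as by (simp add: a(2))
    qed
    then have "Poly_Mapping.lookup t v = (\<Sum>j\<in>J. if (i, j, s j) = v then Suc 0 else 0)"
      by (simp add: lookup_sum lookup_single when_def)
    also have "\<dots> = card {j\<in>J. (i, j, s j) = v}"
      by (simp add: sum.If_cases Int_def)
    finally have eq: "Poly_Mapping.lookup t v = card {j\<in>J. (i, j, s j) = v}" .
    have "card {j\<in>J. (i, j, s j) = v} \<le> card {fst (snd v)}"
      by (rule card_mono) auto
    then have "card {j\<in>J. (i, j, s j) = v} \<le> 1" by simp
    moreover have "\<exists>j. v = (i, j, s j) \<and> (\<exists>r. j \<in> B r)" if "card {j\<in>J. (i, j, s j) = v} \<noteq> 0"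
    proof -
      from that have "{j\<in>J. (i, j, s j) = v} \<noteq> {}" by (metis card.empty)
      then show ?thesis by (auto simp: J_def)
    qed
    ultimately show ?thesis unfolding eq by blast
  qed
  ultimately show ?thesis
    using \<open>6 \<le> k\<close> \<open>k \<le> 12\<close> g t(1)
    by (intro exI[of _ k] exI[of _ g] exI[of _ t] conjI ballI allI) simp_all
qed

section \<open>The Groebner basis\<close>

text \<open>Polynomials vanishing at one coordinate vector form an ideal containing the generators,
  so members that are not multihomogeneous vanish as well.\<close>

lemma resectioning_ideal_eval:
  assumes "f \<in> resectioning_ideal q" "p \<in> resectioning_variety q"
  shows "eval_poly (img_coords p) f = 0"
proof -
  have "resectioning_ideal q \<subseteq> {f. eval_poly (img_coords p) f = 0}"
    unfolding resectioning_ideal_def vanishing_ideal_def ideal_gen_def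
    by (rule cpoly_module.span_minimal)
      (use assms(2) in \<open>auto intro!: cpoly_module.subspaceI simp: eval_poly_add eval_poly_mult\<close>)
  with assms(1) show ?thesis by blast
qed

lemma focals_subset_resectioning_ideal: "focals q k \<subseteq> resectioning_ideal q"
proof
  fix g assume g: "g \<in> focals q k"
  then have "multihomogeneous img_blk g"
    by (metis focalsE multihomogeneous_focal)
  with focal_vanishes[OF g] show "g \<in> resectioning_ideal q"
    unfolding resectioning_ideal_def vanishing_ideal_def ideal_gen_def
    by (intro cpoly_module.span_base) auto
qed

text \<open>Combines the two halves: \<open>unbalanced_camera\<close> finds a camera and a
  potential, and \<open>focal_with_lead_monomial\<close> builds a focal whose leading monomial is
  squarefree in variables dividing that of \<open>f\<close>.\<close>

lemma lead_monomial_divisible_by_focal: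
  fixes q :: "'n::finite \<Rightarrow> complex^4" and f :: "('m::finite, 'n) img_var cpoly"
  assumes q0: "\<And>j. q j \<noteq> 0" and q: "\<And>J. card J = 4 \<Longrightarrow> \<not> coplanar_points (q ` J)"
    and r: "monomial_order r" and f: "f \<in> resectioning_ideal q" "f \<noteq> 0"
  shows "\<exists>g u. g \<in> (\<Union>k\<in>{6..12}. focals q k) \<and> g \<noteq> 0 \<and> lead_monomial r f = u + lead_monomial r g"
proof -
  let ?l = "Poly_Mapping.lookup"
  define G :: "('m, 'n) img_var cpoly set" where "G = (\<Union>k\<in>{6..12}. focals q k)"
  \<comment> \<open>The weights must represent the order on \<open>f\<close> and on all candidate
    focals at once, since the focal is found only after the weights are fixed.\<close>
  define E where "E = Poly_Mapping.keys f \<union> (\<Union>g\<in>G. Poly_Mapping.keys g)"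
  have "finite E"
    by (auto simp: E_def G_def finite_focals)
  then obtain w where
    w: "\<And>s t. s \<in> E \<Longrightarrow> t \<in> E \<Longrightarrow> (s, t) \<in> r \<Longrightarrow> s \<noteq> t \<Longrightarrow> weight w s < weight w t"
    by (rule monomial_order_weight[OF r]) blast
  define T where "T = lead_monomial r f"
  have T: "T \<in> Poly_Mapping.keys f" "\<And>u. u \<in> Poly_Mapping.keys f \<Longrightarrow> u \<noteq> T \<Longrightarrow> weight w u < weight w T"
    using lead_monomial[OF r f(2)] by (auto simp: T_def E_def intro!: w)
  have "\<exists>i \<nu>. \<forall>a. 3 < card {j. \<exists>b\<in>{b. ?l T (i, j, b) \<noteq> 0}. w (i, j, a) + \<nu> a < w (i, j, b) + \<nu> b}"
    by (rule unbalanced_camera) (fact q0 q resectioning_ideal_eval[OF f(1)] T)+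
  then obtain i \<nu> where
    card: "\<forall>a. 3 < card {j. \<exists>b\<in>{b. ?l T (i, j, b) \<noteq> 0}. w (i, j, a) + \<nu> a < w (i, j, b) + \<nu> b}"
    by (elim exE)
  define S where "S j = {b. ?l T (i, j, b) \<noteq> 0}" for j
  \<comment> \<open>Chooses for each point a variable dividing \<open>T\<close> of maximal adjusted
    weight; for empty \<open>S j\<close> the choice is arbitrary.\<close>
  have "\<exists>b. S j \<noteq> {} \<longrightarrow> b \<in> S j \<and> (\<forall>a\<in>S j. w (i, j, a) + \<nu> a \<le> w (i, j, b) + \<nu> b)" for j
  proof (cases "S j = {}")
    case False
    have "Max ((\<lambda>a. w (i, j, a) + \<nu> a) ` S j) \<in> (\<lambda>a. w (i, j, a) + \<nu> a) ` S j"
      by (rule Max_in) (use False in auto)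
    then obtain b where b: "b \<in> S j" "Max ((\<lambda>a. w (i, j, a) + \<nu> a) ` S j) = w (i, j, b) + \<nu> b" by blast
    have "w (i, j, a) + \<nu> a \<le> w (i, j, b) + \<nu> b" if "a \<in> S j" for a
      unfolding b(2)[symmetric] by (rule Max_ge) (use that in auto)
    with b(1) show ?thesis by blast
  qed auto
  then obtain s where s: "\<forall>j. S j \<noteq> {} \<longrightarrow> s j \<in> S j \<and> (\<forall>a\<in>S j. w (i, j, a) + \<nu> a \<le> w (i, j, s j) + \<nu> (s j))"
    using choice[of "\<lambda>j b. S j \<noteq> {} \<longrightarrow> b \<in> S j \<and> (\<forall>a\<in>S j. w (i, j, a) + \<nu> a \<le> w (i, j, b) + \<nu> b)"]
    by auto
  define C where "C a = {j. \<exists>b\<in>S j. w (i, j, a) + \<nu> a < w (i, j, b) + \<nu> b}" for a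
  have "\<exists>B\<subseteq>C a. card B = 4" for a
  proof -
    have "4 \<le> card (C a)"
      using card[rule_format, of a] by (simp add: S_def C_def)
    then show ?thesis by (rule obtain_subset_with_card_n) blast
  qed
  then obtain B where B: "\<And>a. B a \<subseteq> C a" "\<And>a. card (B a) = 4"
    by metis
  have Bs: "w (i, j, a) + \<nu> a < w (i, j, s j) + \<nu> (s j)" "s j \<in> S j" if "j \<in> B a" for a j
  proof -
    from B(1) that have "j \<in> C a" by blast
    then obtain b where b: "b \<in> S j" "w (i, j, a) + \<nu> a < w (i, j, b) + \<nu> b"
      by (auto simp: C_def)
    with s have sj: "s j \<in> S j" "w (i, j, b) + \<nu> b \<le> w (i, j, s j) + \<nu> (s j)" by blast+
    then show "s j \<in> S j" "w (i, j, a) + \<nu> a < w (i, j, s j) + \<nu> (s j)" using b by auto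
  qed
  have "\<exists>k g t. 6 \<le> k \<and> k \<le> 12 \<and> g \<in> focals q k \<and> t \<in> Poly_Mapping.keys g \<and>
    (\<forall>u\<in>Poly_Mapping.keys g. weight w u \<le> weight w t) \<and>
    (\<forall>v. ?l t v \<le> 1 \<and> (?l t v \<noteq> 0 \<longrightarrow> (\<exists>j. v = (i, j, s j) \<and> (\<exists>r. j \<in> B r))))"
    by (rule focal_with_lead_monomial) (fact q B(2) Bs(1))+
  then obtain k g t where g: "6 \<le> k" "k \<le> 12" "g \<in> focals q k" "t \<in> Poly_Mapping.keys g"
    "\<forall>u\<in>Poly_Mapping.keys g. weight w u \<le> weight w t"
    "\<forall>v. ?l t v \<le> 1 \<and> (?l t v \<noteq> 0 \<longrightarrow> (\<exists>j. v = (i, j, s j) \<and> (\<exists>r. j \<in> B r)))"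
    by (elim exE conjE)
  then have "g \<in> G" by (auto simp: G_def)
  \<comment> \<open>The focal only guarantees weakly maximal weight; as \<open>w\<close> is strictly
    increasing along the order on \<open>E\<close>, no monomial of \<open>g\<close> can lie above
    \<open>t\<close>.\<close>
  have lead: "lead_monomial r g = t"
  proof (rule lead_monomial_eqI[OF r g(4)])
    fix u assume u: "u \<in> Poly_Mapping.keys g"
    then have "weight w u \<le> weight w t" using g(5) by blast
    moreover have "weight w t < weight w u" if "(t, u) \<in> r" "t \<noteq> u"
      by (rule w) (use that u g(4) \<open>g \<in> G\<close> in \<open>auto simp: E_def\<close>)
    ultimately show "(u, t) \<in> r"
      using monomial_orderD(1,4)[OF r] by (metis not_le)
  qed
  have "?l t v \<le> ?l T v" for v
  proof (cases "?l t v = 0")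
    case False
    with g(6) obtain j a where "v = (i, j, s j)" "j \<in> B a" by blast
    with Bs(2) have "?l T v \<noteq> 0" by (auto simp: S_def)
    with g(6) show ?thesis by (metis One_nat_def Suc_leI order_trans neq0_conv)
  qed simp
  then have "T = (T - t) + t"
    by (intro poly_mapping_eqI) (simp add: lookup_add lookup_minus)
  moreover have "g \<noteq> 0" using g(4) by auto
  ultimately show ?thesis
    using \<open>g \<in> G\<close> lead unfolding G_def T_def by blast
qed

text \<open>Division algorithm: a multiple of some \<open>g\<close> cancels the leading term of
  \<open>f\<close>, and well-founded induction on the leading monomial reduces \<open>f\<close> to
  0. Likewise each leading term from \<open>I\<close> is a multiple of one from
  \<open>G\<close>.\<close>

lemma ideal_gen_eqI_divisible:
  fixes I G :: "'v cpoly set"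
  assumes r: "monomial_order r" and I: "cpoly_module.subspace I" and G: "G \<subseteq> I"
    and div: "\<And>f. f \<in> I \<Longrightarrow> f \<noteq> 0 \<Longrightarrow> \<exists>g u. g \<in> G \<and> g \<noteq> 0 \<and> lead_monomial r f = u + lead_monomial r g"
  shows "ideal_gen G = I" and "ideal_gen (lead_term r ` (G - {0})) = ideal_gen (lead_term r ` (I - {0}))"
proof -
  let ?l = "Poly_Mapping.lookup"
  have "f \<in> ideal_gen G" if "f \<in> I" for f
  proof -
    have "f \<in> I \<longrightarrow> f \<noteq> 0 \<longrightarrow> lead_monomial r f = T \<longrightarrow> f \<in> ideal_gen G" for f T
    proof (induction T arbitrary: f rule: wf_induct_rule[OF monomial_orderD(5)[OF r]])
      case (1 T)
      show ?case
      proof (intro impI)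
        assume f: "f \<in> I" "f \<noteq> 0" "lead_monomial r f = T"
        then obtain g u where g: "g \<in> G" "g \<noteq> 0" "T = u + lead_monomial r g"
          using div by metis
        define t where "t = lead_monomial r g"
        define c where "c = ?l f T / ?l g t"
        define h where "h = Poly_Mapping.single u c * g"
        have gt: "?l g t \<noteq> 0" using lead_monomial(1)[OF r g(2)] by (simp add: t_def in_keys_iff)
        have "T \<in> Poly_Mapping.keys f" using lead_monomial(1)[OF r f(2)] f(3) by simp
        with gt have "c \<noteq> 0" by (simp add: c_def in_keys_iff)
        have h_span: "h \<in> ideal_gen G"
          unfolding h_def ideal_gen_def
          by (intro cpoly_module.span_scale cpoly_module.span_base g(1))
        have h_I: "h \<in> I"
          unfolding h_def using g(1) G by (intro cpoly_module.subspace_scale[OF I]) auto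
        have "h \<noteq> 0"
        proof
          assume "h = 0"
          then have "?l h (u + t) = 0" by simp
          with gt \<open>c \<noteq> 0\<close> show False by (simp add: h_def lookup_monomial_mult)
        qed
        have lead_h: "lead_monomial r h = T"
          using lead_monomial_monomial_mult[OF r g(2) \<open>c \<noteq> 0\<close>, of u] g(3) by (simp add: h_def)
        have cancel: "?l (f - h) T = 0"
          using gt g(3) by (simp add: lookup_minus h_def lookup_monomial_mult c_def flip: t_def)
        have "f - h \<in> ideal_gen G"
        proof (cases "f - h = 0")
          case True
          then show ?thesis by (simp add: ideal_gen_def cpoly_module.span_zero)
        next
          case False
          let ?T = "lead_monomial r (f - h)"
          have "?T \<in> Poly_Mapping.keys (f - h)" by (rule lead_monomial(1)[OF r False])
          then have "?T \<in> Poly_Mapping.keys f \<or> ?T \<in> Poly_Mapping.keys h" "?T \<noteq> T"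
            using keys_diff[of f h] cancel by (auto simp: in_keys_iff)
          then have "(?T, T) \<in> r - Id"
            using lead_monomial(2)[OF r f(2), of ?T] lead_monomial(2)[OF r \<open>h \<noteq> 0\<close>, of ?T] f(3) lead_h by auto
          moreover have "f - h \<in> I" by (rule cpoly_module.subspace_diff[OF I f(1) h_I])
          ultimately show ?thesis using 1 False by blast
        qed
        from cpoly_module.span_add[OF this[unfolded ideal_gen_def] h_span[unfolded ideal_gen_def]]
        show "f \<in> ideal_gen G" by (simp add: ideal_gen_def)
      qed
    qed
    then show ?thesis using that
      by (cases "f = 0") (auto simp: ideal_gen_def cpoly_module.span_zero)
  qed
  moreover have "ideal_gen G \<subseteq> I"
    unfolding ideal_gen_def by (rule cpoly_module.span_minimal[OF G I])
  ultimately show "ideal_gen G = I" by blast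
  show "ideal_gen (lead_term r ` (G - {0})) = ideal_gen (lead_term r ` (I - {0}))"
  proof
    show "ideal_gen (lead_term r ` (G - {0})) \<subseteq> ideal_gen (lead_term r ` (I - {0}))"
      unfolding ideal_gen_def using G by (intro cpoly_module.span_mono image_mono) auto
    have "lead_term r f \<in> ideal_gen (lead_term r ` (G - {0}))" if f: "f \<in> I" "f \<noteq> 0" for f
    proof -
      obtain g u where g: "g \<in> G" "g \<noteq> 0" "lead_monomial r f = u + lead_monomial r g"
        using div[OF f] by metis
      have "?l g (lead_monomial r g) \<noteq> 0" using lead_monomial(1)[OF r g(2)] by (simp add: in_keys_iff)
      then have "lead_term r f = Poly_Mapping.single u (?l f (lead_monomial r f) / ?l g (lead_monomial r g)) * lead_term r g"
        by (simp add: lead_term_def mult_single g(3))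
      moreover have "\<dots> \<in> ideal_gen (lead_term r ` (G - {0}))"
        unfolding ideal_gen_def using g by (intro cpoly_module.span_scale cpoly_module.span_base) auto
      ultimately show ?thesis by simp
    qed
    then show "ideal_gen (lead_term r ` (I - {0})) \<subseteq> ideal_gen (lead_term r ` (G - {0}))"
      unfolding ideal_gen_def
      by (intro cpoly_module.span_minimal cpoly_module.subspace_span) auto
  qed
qed

text \<open>Covers the sizes in \<open>6..12\<close> that exceed the number of points.\<close>

lemma focals_eq_empty:
  fixes q :: "'n::finite \<Rightarrow> complex^4"
  assumes "CARD('n) < k"
  shows "focals q k = {}"
proof -
  have "length \<sigma> \<le> CARD('n)" if "distinct \<sigma>" for \<sigma> :: "'n list"
    using that by (metis card_mono distinct_card finite subset_UNIV)
  with assms show ?thesis unfolding focals_def by fastforce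
qed

theorem theorem6:
  fixes q :: "'n::finite \<Rightarrow> complex^4"
  assumes "\<And>j. q j \<noteq> 0"
    and "\<And>J. card J = 4 \<Longrightarrow> \<not> coplanar_points (q ` J)"
  shows "(resectioning_ideal q :: ('m::finite, 'n) img_var cpoly set) = focal_ideal q \<and>
         universal_groebner_basis (\<Union>k\<in>{6..12}. focals q k)
           (resectioning_ideal q :: ('m, 'n) img_var cpoly set)"
proof
  let ?I = "resectioning_ideal q :: ('m, 'n) img_var cpoly set"
  let ?G = "\<Union>k\<in>{6..12}. focals q k :: ('m, 'n) img_var cpoly set"
  have I: "cpoly_module.subspace ?I"
    unfolding resectioning_ideal_def vanishing_ideal_def ideal_gen_def
    by (rule cpoly_module.subspace_span)
  have G: "?G \<subseteq> ?I"
    using focals_subset_resectioning_ideal by blast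
  have div: "\<exists>g u. g \<in> ?G \<and> g \<noteq> 0 \<and> lead_monomial r f = u + lead_monomial r g"
    if "monomial_order r" "f \<in> ?I" "f \<noteq> 0" for r f
    by (rule lead_monomial_divisible_by_focal) (fact assms that)+
  \<comment> \<open>The equality of ideals mentions no order, but it is proved by division, for
    which any one order will do.\<close>
  obtain r :: "('m, 'n) img_var monomial rel" where r: "monomial_order r"
    using monomial_order_exists by blast
  have "?I = ideal_gen ?G"
    by (rule ideal_gen_eqI_divisible(1)[OF r I G div[OF r], symmetric])
  also have "\<dots> \<subseteq> focal_ideal q"
    unfolding focal_ideal_def ideal_gen_def
  proof (rule cpoly_module.span_mono, rule UN_least)
    fix k :: nat assume "k \<in> {6..12}"
    then show "focals q k \<subseteq> (\<Union>k\<in>{6..CARD('n)}. focals q k)"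
      using focals_eq_empty[of k q] by (cases "CARD('n) < k") (auto intro!: bexI[of _ k])
  qed
  finally have "?I \<subseteq> focal_ideal q" .
  moreover have "focal_ideal q \<subseteq> ?I"
    unfolding focal_ideal_def ideal_gen_def
    by (rule cpoly_module.span_minimal[OF _ I]) (use focals_subset_resectioning_ideal in blast)
  ultimately show "?I = focal_ideal q" by blast
  show "universal_groebner_basis ?G ?I"
    unfolding universal_groebner_basis_def groebner_basis_def
  proof (intro allI impI conjI)
    fix r :: "('m, 'n) img_var monomial rel" assume r: "monomial_order r"
    show "ideal_gen (lead_term r ` (?G - {0})) = ideal_gen (lead_term r ` (?I - {0}))"
      by (rule ideal_gen_eqI_divisible(2)[OF r I G div[OF r]])
  qed (use G in \<open>simp_all add: finite_focals\<close>)
qed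

end
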